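(* Let $E=\{\exp_\lambda:\lambda\in(0,1)\cap\mathbb{Q}\}$, where $\exp_\lambda(i)=\lambda^i$. For every $\mathrm{LTL}^{\mathrm{disc}}[E]$ formula $\varphi$ over $AP$ and every threshold $v\in[0,1]\cap\mathbb{Q}$, there exists an alternating weak automaton $\mathcal{A}_{\varphi,v}$ over $2^{AP}$ such that for every computation $\pi$: (1) if $[\![\pi,\varphi]\!]>v$ then $\mathcal{A}_{\varphi,v}$ accepts $\pi$; (2) if $\mathcal{A}_{\varphi,v}$ accepts $\pi$ and $\pi$ is a lasso computation, then $[\![\pi,\varphi]\!]>v$. Furthermore, the number of states of $\mathcal{A}_{\varphi,v}$ is singly exponential in $|\langle\varphi\rangle|$ and in the length of the description of $v$.
   Context: Let $AP$ be a finite set of atomic propositions. A computation is $\pi=\pi_0\pi_1\cdots\in(2^{AP})^\omega$, $\pi^i=\pi_i\pi_{i+1}\cdots$; a lasso computation has the form $u\cdot w^\omega$ with $u,w\in(2^{AP})^*$, $w\neq\epsilon$. For a set $\mathcal{D}$ of strictly decreasing functions $\mathbb{N}\to[0,1]$ tending to $0$, $\mathrm{LTL}^{\mathrm{disc}}[\mathcal{D}]$ formulas are $\varphi ::= \mathtt{True}\mid p\mid\neg\varphi\mid\varphi\vee\varphi\mid\mathsf{X}\varphi\mid\varphi\,\mathsf{U}\,\varphi\mid\varphi\,\mathsf{U}_\eta\,\varphi$ ($p\in AP$, $\eta\in\mathcal{D}$), with values: $[\![\pi,\mathtt{True}]\!]=1$; $[\![\pi,p]\!]=1$ if $p\in\pi_0$,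 else $0$; $[\![\pi,\neg\varphi]\!]=1-[\![\pi,\varphi]\!]$; $[\![\pi,\varphi\vee\psi]\!]=\max\{[\![\pi,\varphi]\!],[\![\pi,\psi]\!]\}$; $[\![\pi,\mathsf{X}\varphi]\!]=[\![\pi^1,\varphi]\!]$; $[\![\pi,\varphi\,\mathsf{U}\,\psi]\!]=\sup_{i\ge0}\min\{[\![\pi^i,\psi]\!],\min_{0\le j<i}[\![\pi^j,\varphi]\!]\}$; $[\![\pi,\varphi\,\mathsf{U}_\eta\,\psi]\!]=\sup_{i\ge0}\min\{\eta(i)[\![\pi^i,\psi]\!],\min_{0\le j<i}\eta(j)[\![\pi^j,\varphi]\!]\}$. For an $\mathrm{LTL}^{\mathrm{disc}}[E]$ formula $\varphi$, $|\langle\varphi\rangle|$ is the number of subformulas of $\varphi$ plus the total length in bits of describing the rationals $\lambda$ such that $\mathsf{U}_{\exp_\lambda}$ occurs in $\varphi$. An alternating B\"uchi automaton is $\langle\Sigma,Q,q_{in},\delta,\alpha\rangle$ with finite $Q$, $\delta:Q\times\Sigma\to\mathcal{B}^+(Q)$ (positive Boolean formulas over $Q$, incl. $\mathtt{True},\mathtt{False}$), $\alpha\subseteq Q$; a run on $w=\sigma_0\sigma_1\cdots$ is a DAG on $Q\times\mathbb{N}$ rooted at $\langle q_{in},0\rangle$ in which the successors of each node $\langle q,l\rangle$ satisfy $\delta(q,\sigma_l)$; it is accepting if all infinite paths visit $\alpha$ infinitely often. It is weak if $Q$ is partitioned into sets each contained in or disjoint from $\alpha$, partially ordered so that transitions never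 lead to a larger set. *)

theory Defs
  imports Complex_Main "HOL-Library.Omega_Words_Fun"
begin

datatype 'ap dltl =
    DTrue
  | DProp 'ap
  | DNot "'ap dltl"
  | DOr "'ap dltl" "'ap dltl"
  | DNext "'ap dltl"
  | DUntil "'ap dltl" "'ap dltl"
  | DUntilExp rat "'ap dltl" "'ap dltl"

fun in_E_fragment :: "'ap dltl \<Rightarrow> bool" where
  "in_E_fragment DTrue = True"
| "in_E_fragment (DProp p) = True"
| "in_E_fragment (DNot f) = in_E_fragment f"
| "in_E_fragment (DOr f g) = (in_E_fragment f \<and> in_E_fragment g)"
| "in_E_fragment (DNext f) = in_E_fragment f"
| "in_E_fragment (DUntil f g) = (in_E_fragment f \<and> in_E_fragment g)"
| "in_E_fragment (DUntilExp l f g) = (0 < l \<and> l < 1 \<and> in_E_fragment f \<and> in_E_fragment g)"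

definition exp_disc :: "rat \<Rightarrow> nat \<Rightarrow> real" where
  "exp_disc l i = (real_of_rat l) ^ i"

text \<open>Minimum over j < i of a real sequence, with min over the empty set equal to 1
  (the neutral element on [0,1]).\<close>
definition min_below :: "(nat \<Rightarrow> real) \<Rightarrow> nat \<Rightarrow> real" where
  "min_below f i = Min (insert 1 (f ` {..<i}))"

fun dval :: "'ap set word \<Rightarrow> 'ap dltl \<Rightarrow> real" where
  "dval \<pi> DTrue = 1"
| "dval \<pi> (DProp p) = (if p \<in> \<pi> 0 then 1 else 0)"
| "dval \<pi> (DNot f) = 1 - dval \<pi> f"
| "dval \<pi> (DOr f g) = max (dval \<pi> f) (dval \<pi> g)"
| "dval \<pi> (DNext f) = dval (suffix 1 \<pi>) f"
| "dval \<pi> (DUntil f g) =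
     (SUP i. min (dval (suffix i \<pi>) g) (min_below (\<lambda>j. dval (suffix j \<pi>) f) i))"
| "dval \<pi> (DUntilExp l f g) =
     (SUP i. min (exp_disc l i * dval (suffix i \<pi>) g)
                 (min_below (\<lambda>j. exp_disc l j * dval (suffix j \<pi>) f) i))"

definition is_lasso :: "'a word \<Rightarrow> bool" where
  "is_lasso \<pi> \<longleftrightarrow> (\<exists>u w. w \<noteq> [] \<and> \<pi> = u \<frown> w\<^sup>\<omega>)"

fun subformulas :: "'ap dltl \<Rightarrow> 'ap dltl set" where
  "subformulas DTrue = {DTrue}"
| "subformulas (DProp p) = {DProp p}"
| "subformulas (DNot f) = insert (DNot f) (subformulas f)"
| "subformulas (DOr f g) = insert (DOr f g) (subformulas f \<union> subformulas g)"
| "subformulas (DNext f) = insert (DNext f) (subformulas f)"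
| "subformulas (DUntil f g) = insert (DUntil f g) (subformulas f \<union> subformulas g)"
| "subformulas (DUntilExp l f g) = insert (DUntilExp l f g) (subformulas f \<union> subformulas g)"

fun discounts :: "'ap dltl \<Rightarrow> rat set" where
  "discounts DTrue = {}"
| "discounts (DProp p) = {}"
| "discounts (DNot f) = discounts f"
| "discounts (DOr f g) = discounts f \<union> discounts g"
| "discounts (DNext f) = discounts f"
| "discounts (DUntil f g) = discounts f \<union> discounts g"
| "discounts (DUntilExp l f g) = insert l (discounts f \<union> discounts g)"

fun bitlen :: "nat \<Rightarrow> nat" where
  "bitlen n = (if n \<le> 1 then 1 else Suc (bitlen (n div 2)))"

text \<open>Length of the description of a rational p/q (in lowest terms): sign bit plus
  binary numerator plus binary denominator.\<close>
definition rat_bits :: "rat \<Rightarrow> nat" where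
  "rat_bits r = (case quotient_of r of (p, q) \<Rightarrow> 1 + bitlen (nat \<bar>p\<bar>) + bitlen (nat q))"

definition dsize :: "'ap dltl \<Rightarrow> nat" where
  "dsize \<phi> = card (subformulas \<phi>) + (\<Sum>l\<in>discounts \<phi>. rat_bits l)"

datatype 'q pbf = PTrue | PFalse | PVar 'q | PAnd "'q pbf" "'q pbf" | POr "'q pbf" "'q pbf"

fun pbf_sat :: "'q set \<Rightarrow> 'q pbf \<Rightarrow> bool" where
  "pbf_sat S PTrue = True"
| "pbf_sat S PFalse = False"
| "pbf_sat S (PVar q) = (q \<in> S)"
| "pbf_sat S (PAnd a b) = (pbf_sat S a \<and> pbf_sat S b)"
| "pbf_sat S (POr a b) = (pbf_sat S a \<or> pbf_sat S b)"

fun pbf_atoms :: "'q pbf \<Rightarrow> 'q set" where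
  "pbf_atoms PTrue = {}"
| "pbf_atoms PFalse = {}"
| "pbf_atoms (PVar q) = {q}"
| "pbf_atoms (PAnd a b) = pbf_atoms a \<union> pbf_atoms b"
| "pbf_atoms (POr a b) = pbf_atoms a \<union> pbf_atoms b"

record 's aba =
  states :: "nat set"
  init :: nat
  trans :: "nat \<Rightarrow> 's \<Rightarrow> nat pbf"
  acc :: "nat set"

definition aba_wf :: "'s aba \<Rightarrow> bool" where
  "aba_wf A \<longleftrightarrow> finite (states A) \<and> init A \<in> states A \<and> acc A \<subseteq> states A
     \<and> (\<forall>q\<in>states A. \<forall>\<sigma>. pbf_atoms (trans A q \<sigma>) \<subseteq> states A)"

text \<open>A run DAG is given by a successor function: rho l q is the set of successors
  (at level l+1) of node (q, l). Nodes of the DAG are those reachable from the root.\<close>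
inductive run_node :: "'s aba \<Rightarrow> (nat \<Rightarrow> nat \<Rightarrow> nat set) \<Rightarrow> nat \<times> nat \<Rightarrow> bool"
  for A \<rho> where
  root: "run_node A \<rho> (init A, 0)"
| step: "run_node A \<rho> (q, l) \<Longrightarrow> q' \<in> \<rho> l q \<Longrightarrow> run_node A \<rho> (q', Suc l)"

definition is_run :: "'s aba \<Rightarrow> 's word \<Rightarrow> (nat \<Rightarrow> nat \<Rightarrow> nat set) \<Rightarrow> bool" where
  "is_run A w \<rho> \<longleftrightarrow> (\<forall>q l. run_node A \<rho> (q, l) \<longrightarrow>
       \<rho> l q \<subseteq> states A \<and> pbf_sat (\<rho> l q) (trans A q (w l)))"

definition accepting_run :: "'s aba \<Rightarrow> (nat \<Rightarrow> nat \<Rightarrow> nat set) \<Rightarrow> bool" where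
  "accepting_run A \<rho> \<longleftrightarrow> (\<forall>p. p 0 = init A \<and> (\<forall>i. p (Suc i) \<in> \<rho> i (p i))
       \<longrightarrow> (\<exists>\<^sub>\<infinity>i. p i \<in> acc A))"

definition aba_accepts :: "'s aba \<Rightarrow> 's word \<Rightarrow> bool" where
  "aba_accepts A w \<longleftrightarrow> (\<exists>\<rho>. is_run A w \<rho> \<and> accepting_run A \<rho>)"

definition aba_weak :: "'s aba \<Rightarrow> bool" where
  "aba_weak A \<longleftrightarrow> (\<exists>P R.
      (\<forall>B\<in>P. B \<noteq> {}) \<and> \<Union>P = states A \<and> (\<forall>B\<in>P. \<forall>B'\<in>P. B \<noteq> B' \<longrightarrow> B \<inter> B' = {})
    \<and> (\<forall>B\<in>P. B \<subseteq> acc A \<or> B \<inter> acc A = {})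
    \<and> partial_order_on P R
    \<and> (\<forall>B\<in>P. \<forall>B'\<in>P. \<forall>q\<in>B. \<forall>q'\<in>B'. \<forall>\<sigma>.
          q' \<in> pbf_atoms (trans A q \<sigma>) \<longrightarrow> (B', B) \<in> R))"

end

theory Submission
  imports Defs "HOL-Library.Countable"
begin

text \<open>
  States \<open>\<psi> > t\<close> and \<open>\<psi> < t\<close> are unfolded along the expansion
  \<open>\<phi> U \<psi> = max \<psi> (min \<phi> (\<lambda> * X (\<phi> U \<psi>)))\<close>, where \<open>\<lambda> = 1\<close> for the undiscounted until: a factor \<open>\<lambda>\<close>
  turns a threshold \<open>t\<close> into \<open>t / \<lambda>\<close>, and thresholds above 1 are decided. The expansion is exact on all
  words, and the only cycles are self-loops at untils. These have to be left for \<open>>\<close>, while staying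
  forever in a state \<open>\<phi> U \<psi> < t\<close> only shows that all values of \<open>\<psi>\<close> are below \<open>t\<close>, which bounds
  the supremum strictly if it is attained, as on a lasso.

  For the size: if the threshold \<open>t\<close> has a denominator of at most \<open>B\<close> bits, then \<open>t \<ge> 2\<^sup>-\<^sup>B\<close>, and
  since \<open>\<lambda> \<le> 1 - 2\<^sup>-\<^sup>N\<close>, only the divisions by \<open>\<lambda>\<^sup>i\<close> with \<open>i \<le> B 2\<^sup>N\<close> stay below 1. So each nesting level
  multiplies both the number of thresholds and the length of their denominators by a singly
  exponential factor.
\<close>

text \<open>Automaton states are natural numbers, so the triples that serve as states have to be
  encoded by \<open>to_nat\<close>.\<close>

instance dltl :: (countable) countable
  by countable_datatype

section \<open>Until values\<close>

text \<open>The factor \<open>l = 1\<close> gives the undiscounted until, so both untils are treated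
  at once. The sequences \<open>f\<close> and \<open>g\<close> stand for the values of the operands
  along the suffixes.\<close>

definition uval :: "real \<Rightarrow> (nat \<Rightarrow> real) \<Rightarrow> (nat \<Rightarrow> real) \<Rightarrow> real" where
  "uval l f g = (SUP i. min (l ^ i * g i) (min_below (\<lambda>j. l ^ j * f j) i))"

text \<open>The conjunct \<open>x < 1\<close> comes from the default 1 of the minimum.\<close>

lemma less_min_below_iff: "x < min_below F i \<longleftrightarrow> x < 1 \<and> (\<forall>j<i. x < F j)"
  unfolding min_below_def by (subst Min_gr_iff) auto

lemma discounted_le:
  fixes l y :: real
  assumes "0 < l" "l \<le> 1" "0 \<le> y"
  shows "l ^ i * y \<le> y"
  using assms by (simp add: mult_left_le_one_le power_le_one)

context
  fixes l :: real and f g :: "nat \<Rightarrow> real"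
  assumes l: "0 < l" "l \<le> 1"
    and f: "\<And>i. 0 \<le> f i" "\<And>i. f i \<le> 1"
    and g: "\<And>i. 0 \<le> g i" "\<And>i. g i \<le> 1"
begin

lemma bdd_above_uval: "bdd_above (range (\<lambda>i. min (l ^ i * g i) (min_below (\<lambda>j. l ^ j * f j) i)))"
proof (rule bdd_aboveI2)
  show "min (l ^ i * g i) (min_below (\<lambda>j. l ^ j * f j) i) \<le> 1" for i
    using discounted_le[OF l g(1)[of i], of i] g(2)[of i] by linarith
qed

text \<open>A supremum strictly exceeds \<open>x\<close> iff one of its members does, so strict
  lower bounds are witnessed at a single index whether or not the supremum is attained.\<close>

lemma less_uval_iff:
  "x < uval l f g \<longleftrightarrow> x < 1 \<and> (\<exists>i. x < l ^ i * g i \<and> (\<forall>j<i. x < l ^ j * f j))"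
  unfolding uval_def
  by (subst less_cSUP_iff[OF _ bdd_above_uval]) (auto simp: less_min_below_iff)

lemma uval_bounds: "0 \<le> uval l f g" "uval l f g \<le> 1"
proof -
  show "uval l f g \<le> 1"
    using less_uval_iff[of 1] by (simp add: not_less[symmetric])
  show "0 \<le> uval l f g"
  proof (rule ccontr)
    assume *: "\<not> 0 \<le> uval l f g"
    \<comment> \<open>Index 0 has no \<open>f\<close> below it and \<open>g 0\<close> is
      nonnegative, so a negative supremum would exceed itself.\<close>
    then have "uval l f g < l ^ 0 * g 0 \<and> (\<forall>j<0. uval l f g < l ^ j * f j)"
      using g(1)[of 0] by simp
    then have "uval l f g < uval l f g"
      using less_uval_iff[of "uval l f g"] * by (meson less_trans not_le zero_less_one)
    then show False by simp
  qed
qed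

end

text \<open>Both sides have the same strict lower bounds \<open>x\<close>: index 0 contributes
  \<open>g 0\<close>, and index \<open>Suc i\<close> contributes \<open>f 0\<close> together with
  the shifted sequences at threshold \<open>x / l\<close>.\<close>

lemma uval_unfold:
  assumes l: "0 < l" "l \<le> 1"
    and f: "\<And>i. 0 \<le> f i" "\<And>i. f i \<le> 1"
    and g: "\<And>i. 0 \<le> g i" "\<And>i. g i \<le> 1"
  shows "uval l f g = max (g 0) (min (f 0) (l * uval l (\<lambda>i. f (Suc i)) (\<lambda>i. g (Suc i))))"
    (is "_ = ?r")
proof -
  have "x < uval l f g \<longleftrightarrow> x < ?r" for x
  proof (cases "x < 1")
    case False
    have "?r \<le> 1"
      using f(2)[of 0] g(2)[of 0] by linarith
    moreover have "uval l f g \<le> 1" by (rule uval_bounds[OF l f g])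
    ultimately show ?thesis using False by linarith
  next
    case True
    let ?P = "\<lambda>i. x < l ^ i * g i \<and> (\<forall>j<i. x < l ^ j * f j)"
    let ?Q = "\<lambda>i. x / l < l ^ i * g (Suc i) \<and> (\<forall>j<i. x / l < l ^ j * f (Suc j))"
    have scale: "x < l ^ Suc i * y \<longleftrightarrow> x / l < l ^ i * y" for i y
      using l by (simp add: pos_divide_less_eq mult_ac)
    have PQ: "?P (Suc i) \<longleftrightarrow> x < f 0 \<and> ?Q i" for i
      unfolding All_less_Suc2 scale by auto
    \<comment> \<open>The side condition of \<open>less_uval_iff\<close> at \<open>x / l\<close> is
      implied by any witness, because discounted values are at most 1.\<close>
    have "x / l < 1" if "x / l < l ^ i * g (Suc i)" for i
      using that discounted_le[OF l g(1)[of "Suc i"], of i] g(2)[of "Suc i"] by linarith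
    then have "(\<exists>i. ?Q i) \<longleftrightarrow> x / l < 1 \<and> (\<exists>i. ?Q i)" by blast
    also have "\<dots> \<longleftrightarrow> x / l < uval l (\<lambda>i. f (Suc i)) (\<lambda>i. g (Suc i))"
      by (rule less_uval_iff[symmetric]) (use l f g in auto)
    finally have "(\<exists>i. ?P (Suc i)) \<longleftrightarrow> x < f 0 \<and> x / l < uval l (\<lambda>i. f (Suc i)) (\<lambda>i. g (Suc i))"
      unfolding PQ by blast
    also have "\<dots> \<longleftrightarrow> x < f 0 \<and> x < l * uval l (\<lambda>i. f (Suc i)) (\<lambda>i. g (Suc i))"
      using l by (simp add: pos_divide_less_eq mult.commute)
    finally have "(\<exists>i. ?P (Suc i)) \<longleftrightarrow> \<dots>" .
    moreover have "(\<exists>i. R i) \<longleftrightarrow> R 0 \<or> (\<exists>i. R (Suc i))" for R :: "nat \<Rightarrow> bool"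
      by (metis not0_implies_Suc)
    from this[of ?P] have "(\<exists>i. ?P i) \<longleftrightarrow> x < g 0 \<or> (\<exists>i. ?P (Suc i))"
      by simp
    ultimately have "(\<exists>i. ?P i) \<longleftrightarrow> x < g 0 \<or> x < f 0 \<and> x < l * uval l (\<lambda>i. f (Suc i)) (\<lambda>i. g (Suc i))"
      by (simp only:)
    then show ?thesis
      unfolding less_uval_iff[OF l f g] less_max_iff_disj min_less_iff_conj
      using True by (simp only: simp_thms)
  qed
  \<comment> \<open>Neither side is strictly below itself, so these two instances exclude both
    strict inequalities.\<close>
  from this[of ?r] this[of "uval l f g"] show ?thesis by linarith
qed

section \<open>Bounds and one-step expansion of formula values\<close>

lemma dval_bounds:
  assumes "in_E_fragment \<psi>"
  shows "0 \<le> dval \<pi> \<psi>" "dval \<pi> \<psi> \<le> 1"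
proof -
  have "0 \<le> dval \<pi> \<psi> \<and> dval \<pi> \<psi> \<le> 1"
    using assms
  proof (induction \<psi> arbitrary: \<pi>)
    case (DUntil f g)
    then show ?case
      using uval_bounds[of 1 "\<lambda>j. dval (suffix j \<pi>) f" "\<lambda>j. dval (suffix j \<pi>) g"]
      by (auto simp: uval_def)
  next
    case (DUntilExp l f g)
    then show ?case
      using uval_bounds[of "of_rat l" "\<lambda>j. dval (suffix j \<pi>) f" "\<lambda>j. dval (suffix j \<pi>) g"]
      by (auto simp: uval_def exp_disc_def)
  qed (auto simp: max_def)
  then show "0 \<le> dval \<pi> \<psi>" "dval \<pi> \<psi> \<le> 1" by auto
qed

lemma dval_DUntil_uval:
  "dval \<pi> (DUntil f g) = uval 1 (\<lambda>i. dval (suffix i \<pi>) f) (\<lambda>i. dval (suffix i \<pi>) g)"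
  by (simp add: uval_def)

lemma dval_DUntilExp_uval:
  "dval \<pi> (DUntilExp l f g) =
     uval (of_rat l) (\<lambda>i. dval (suffix i \<pi>) f) (\<lambda>i. dval (suffix i \<pi>) g)"
  by (simp add: uval_def exp_disc_def)

lemma dval_DUntil_unfold:
  assumes "in_E_fragment (DUntil f g)"
  shows "dval \<pi> (DUntil f g) = max (dval \<pi> g) (min (dval \<pi> f) (dval (suffix 1 \<pi>) (DUntil f g)))"
  unfolding dval_DUntil_uval using assms
  by (subst uval_unfold) (auto simp: dval_bounds)

lemma dval_DUntilExp_unfold:
  assumes "in_E_fragment (DUntilExp l f g)"
  shows "dval \<pi> (DUntilExp l f g) =
     max (dval \<pi> g) (min (dval \<pi> f) (of_rat l * dval (suffix 1 \<pi>) (DUntilExp l f g)))"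
  unfolding dval_DUntilExp_uval using assms
  by (subst uval_unfold) (auto simp: dval_bounds)

text \<open>Past the prefix \<open>u\<close>, a suffix depends only on its offset modulo
  \<open>length w\<close>.\<close>

lemma finite_suffixes_lasso:
  assumes "is_lasso \<pi>"
  shows "finite (range (\<lambda>i. suffix i \<pi>))"
proof -
  obtain u w where w: "w \<noteq> []" and \<pi>: "\<pi> = u \<frown> w\<^sup>\<omega>"
    using assms by (auto simp: is_lasso_def)
  have "suffix i \<pi> \<in> (\<lambda>i. suffix i \<pi>) ` {..< length u + length w}" for i
  proof (cases "i < length u")
    case True
    then show ?thesis by auto
  next
    case False
    let ?k = "length u + (i - length u) mod length w"
    have "suffix i \<pi> n = suffix ?k \<pi> n" for n
    proof -
      have "i + n - length u = (i - length u) + n" using False by simp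
      then show ?thesis
        using False w by (simp add: \<pi> conc_def mod_add_left_eq)
    qed
    then have "suffix i \<pi> = suffix ?k \<pi>" by blast
    moreover have "?k < length u + length w" using w by simp
    ultimately show ?thesis by blast
  qed
  then have "range (\<lambda>i. suffix i \<pi>) \<subseteq> (\<lambda>i. suffix i \<pi>) ` {..< length u + length w}" by blast
  then show ?thesis by (rule finite_subset) simp
qed

text \<open>The only use of the lasso assumption is the finiteness of the range of \<open>g\<close>, which makes the
  supremum a maximum.\<close>
lemma uval_less_lasso:
  assumes l: "0 < l" "l \<le> 1"
    and f: "\<And>i. 0 \<le> f i" "\<And>i. f i \<le> 1"
    and g: "\<And>i. 0 \<le> g i" "\<And>i. g i \<le> 1"
    and fin: "finite (range g)" and less: "\<And>i. g i < t"
  shows "uval l f g < t"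
proof -
  have "uval l f g \<le> Max (range g)"
    unfolding uval_def
  proof (rule cSUP_least)
    show "min (l ^ i * g i) (min_below (\<lambda>j. l ^ j * f j) i) \<le> Max (range g)" for i
      using discounted_le[OF l g(1)[of i], of i] Max_ge[OF fin, of "g i"] by auto
  qed simp
  also have "\<dots> < t" using fin less by (subst Max_less_iff) auto
  finally show ?thesis .
qed

section \<open>Transitions\<close>

text \<open>The state \<^term>\<open>(\<psi>, True, t)\<close> asserts that the value of \<open>\<psi>\<close> exceeds \<open>t\<close>,
  the state \<^term>\<open>(\<psi>, False, t)\<close> that it is below \<open>t\<close>.\<close>
type_synonym 'ap thr = "'ap dltl \<times> bool \<times> rat"

text \<open>Both polarities are strict, which keeps the family closed under negation:
  \<open>1 - x > t\<close> iff \<open>x < 1 - t\<close>.\<close>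

definition cmp :: "bool \<Rightarrow> rat \<Rightarrow> real \<Rightarrow> bool" where
  "cmp b t x \<longleftrightarrow> (if b then of_rat t < x else x < of_rat t)"

definition holds :: "'ap set word \<Rightarrow> 'ap thr \<Rightarrow> bool" where
  "holds \<pi> = (\<lambda>(\<psi>, b, t). cmp b t (dval \<pi> \<psi>))"

definition pbf_const :: "bool \<Rightarrow> 'q pbf" where
  "pbf_const x = (if x then PTrue else PFalse)"

text \<open>\<open>b\<close> selects between a formula and its dual.\<close>
definition pbf_join :: "bool \<Rightarrow> 'q pbf \<Rightarrow> 'q pbf \<Rightarrow> 'q pbf" where
  "pbf_join b = (if b then POr else PAnd)"

text \<open>Only \<open>DNext\<close> and the untils create successor states; everything else is
  resolved on the current letter. A threshold above 1 exceeds every value, so the upper comparison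
  fails and the lower one succeeds, whence \<open>pbf_const (\<not> b)\<close>.\<close>

fun step :: "'ap dltl \<Rightarrow> bool \<Rightarrow> rat \<Rightarrow> 'ap set \<Rightarrow> 'ap thr pbf" where
  "step DTrue b t \<sigma> = pbf_const (cmp b t 1)"
| "step (DProp p) b t \<sigma> = pbf_const (cmp b t (if p \<in> \<sigma> then 1 else 0))"
| "step (DNot f) b t \<sigma> = step f (\<not> b) (1 - t) \<sigma>"
| "step (DOr f g) b t \<sigma> = pbf_join b (step f b t \<sigma>) (step g b t \<sigma>)"
| "step (DNext f) b t \<sigma> = PVar (f, b, t)"
| "step (DUntil f g) b t \<sigma> =
     pbf_join b (step g b t \<sigma>) (pbf_join (\<not> b) (step f b t \<sigma>) (PVar (DUntil f g, b, t)))"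
| "step (DUntilExp l f g) b t \<sigma> =
     pbf_join b (step g b t \<sigma>) (pbf_join (\<not> b) (step f b t \<sigma>)
       (if t / l \<le> 1 then PVar (DUntilExp l f g, b, t / l) else pbf_const (\<not> b)))"

lemma pbf_sat_const [simp]: "pbf_sat S (pbf_const x) \<longleftrightarrow> x"
  by (simp add: pbf_const_def)

lemma pbf_sat_join [simp]:
  "pbf_sat S (pbf_join b x y) \<longleftrightarrow> (if b then pbf_sat S x \<or> pbf_sat S y else pbf_sat S x \<and> pbf_sat S y)"
  by (simp add: pbf_join_def)

lemma pbf_atoms_const [simp]: "pbf_atoms (pbf_const x) = {}"
  by (simp add: pbf_const_def)

lemma pbf_atoms_join [simp]: "pbf_atoms (pbf_join b x y) = pbf_atoms x \<union> pbf_atoms y"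
  by (simp add: pbf_join_def)

text \<open>Positivity gives monotonicity. Restricting to the occurring atoms allows successor sets
  to be trimmed to them.\<close>

lemma pbf_sat_mono: "pbf_sat S x \<Longrightarrow> S \<inter> pbf_atoms x \<subseteq> S' \<Longrightarrow> pbf_sat S' x"
  by (induction x) auto

lemma pbf_sat_map [simp]: "pbf_sat S (map_pbf e x) \<longleftrightarrow> pbf_sat (e -` S) x"
  by (induction x) auto

lemma pbf_atoms_map [simp]: "pbf_atoms (map_pbf e x) = e ` pbf_atoms x"
  by (induction x) auto

lemma holds_iff [simp]: "holds \<pi> (\<psi>, b, t) \<longleftrightarrow> cmp b t (dval \<pi> \<psi>)"
  by (simp add: holds_def)

lemma cmp_max: "cmp b t (max x y) \<longleftrightarrow> (if b then cmp b t x \<or> cmp b t y else cmp b t x \<and> cmp b t y)"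
  by (auto simp: cmp_def)

lemma cmp_min: "cmp b t (min x y) \<longleftrightarrow> (if b then cmp b t x \<and> cmp b t y else cmp b t x \<or> cmp b t y)"
  by (auto simp: cmp_def)

text \<open>The comparisons commute with maximum and minimum, so the expansion laws carry over to
  \<open>step\<close>. Reading each successor state as its own truth at the next position makes the
  transition formula exact, on every word and for both polarities.\<close>

lemma pbf_sat_step_iff:
  assumes "in_E_fragment \<psi>" and \<pi>': "\<pi>' = suffix 1 \<pi>"
  shows "pbf_sat {q. holds \<pi>' q} (step \<psi> b t (\<pi> 0)) \<longleftrightarrow> holds \<pi> (\<psi>, b, t)"
  using assms(1)
proof (induction \<psi> arbitrary: b t)
  case (DNot f)
  then show ?case by (auto simp: cmp_def of_rat_diff)
next
  case (DNext f)
  then show ?case by (simp add: \<pi>' suffix_def)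
next
  case (DUntil f g)
  have "cmp b t (dval \<pi> (DUntil f g)) \<longleftrightarrow>
    cmp b t (max (dval \<pi> g) (min (dval \<pi> f) (dval \<pi>' (DUntil f g))))"
    unfolding \<pi>' by (rule arg_cong[OF dval_DUntil_unfold[OF DUntil.prems]])
  then show ?case
    using DUntil.IH[of b t] DUntil.prems
    by (cases b) (simp_all add: cmp_max cmp_min del: dval.simps)
next
  case (DUntilExp l f g)
  let ?u = "dval \<pi>' (DUntilExp l f g)"
  have unfold: "cmp b t (dval \<pi> (DUntilExp l f g)) \<longleftrightarrow>
    cmp b t (max (dval \<pi> g) (min (dval \<pi> f) (of_rat l * ?u)))"
    unfolding \<pi>' by (rule arg_cong[OF dval_DUntilExp_unfold[OF DUntilExp.prems]])
  have l: "0 < (of_rat l :: real)" using DUntilExp.prems by simp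
  have scale: "cmp b t (of_rat l * ?u) \<longleftrightarrow> cmp b (t / l) ?u"
    using l unfolding cmp_def of_rat_divide
    by (cases b) (simp_all only: if_True if_False pos_divide_less_eq pos_less_divide_eq mult.commute[of "of_rat l"])
  have cap: "cmp b (t / l) ?u \<longleftrightarrow> \<not> b" if "\<not> t / l \<le> 1"
  proof -
    have "?u \<le> 1" by (rule dval_bounds[OF DUntilExp.prems])
    moreover have "1 < (of_rat (t / l) :: real)"
      using that by (simp del: of_rat_divide)
    ultimately have "?u < of_rat (t / l)" "\<not> of_rat (t / l) < ?u" by linarith+
    then show ?thesis
      by (cases b) (simp_all only: cmp_def if_True if_False simp_thms)
  qed
  have var: "pbf_sat {q. holds \<pi>' q}
       (if t / l \<le> 1 then PVar (DUntilExp l f g, b, t / l) else pbf_const (\<not> b))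
     \<longleftrightarrow> cmp b t (of_rat l * ?u)"
  proof (cases "t / l \<le> 1")
    case True
    show ?thesis
      unfolding if_P[OF True] scale pbf_sat.simps mem_Collect_eq holds_iff by (rule refl)
  next
    case False
    show ?thesis
      unfolding if_not_P[OF False] scale cap[OF False] pbf_sat_const by (rule refl)
  qed
  have IH: "pbf_sat {q. holds \<pi>' q} (step f b t (\<pi> 0)) \<longleftrightarrow> cmp b t (dval \<pi> f)"
    "pbf_sat {q. holds \<pi>' q} (step g b t (\<pi> 0)) \<longleftrightarrow> cmp b t (dval \<pi> g)"
    using DUntilExp.IH[of b t] DUntilExp.prems by (simp_all only: in_E_fragment.simps holds_iff simp_thms)
  show ?case
    unfolding holds_iff unfold step.simps pbf_sat_join cmp_max cmp_min var IH
    by (cases b) (simp_all only: if_True if_False simp_thms)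
next
  case (DOr f g)
  then show ?case by (simp add: cmp_max)
next
  case DTrue
  show ?case unfolding step.simps pbf_sat_const holds_iff dval.simps ..
next
  case (DProp p)
  show ?case unfolding step.simps pbf_sat_const holds_iff dval.simps ..
qed

lemma pbf_sat_step_suffix_iff:
  assumes "in_E_fragment \<psi>"
  shows "pbf_sat {q. holds (suffix (Suc i) \<pi>) q} (step \<psi> b t (\<pi> i)) \<longleftrightarrow> holds (suffix i \<pi>) (\<psi>, b, t)"
  using pbf_sat_step_iff[OF assms, of "suffix (Suc i) \<pi>" "suffix i \<pi>"] by simp

section \<open>The order on states\<close>

text \<open>Separates a self-loop from the rest of a transition: the step of a smaller operand
  cannot lead back to the whole formula.\<close>

lemma size_step_atoms: "(\<chi>, c, s) \<in> pbf_atoms (step \<psi> b t \<sigma>) \<Longrightarrow> size \<chi> \<le> size \<psi>"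
  by (induction \<psi> arbitrary: b t) (fastforce split: if_splits)+

text \<open>Thresholds increase along self-loops of discounted untils, so that every component of the
  automaton is a singleton.\<close>
definition below :: "'ap thr \<Rightarrow> 'ap thr \<Rightarrow> bool" where
  "below = (\<lambda>(\<psi>', b', t') (\<psi>, b, t). size \<psi>' < size \<psi> \<or> \<psi>' = \<psi> \<and> b' = b \<and> t < t')"

lemma below_irrefl: "\<not> below q q"
  by (auto simp: below_def)

lemma below_trans: "below p q \<Longrightarrow> below q r \<Longrightarrow> below p r"
  by (auto simp: below_def)

text \<open>On all triples \<open>below\<close> descends forever, since rational thresholds can keep
  growing. On a finite set transitivity and irreflexivity suffice.\<close>

lemma wf_below:
  assumes "finite C"
  shows "wf {(p, q). p \<in> C \<and> q \<in> C \<and> below p q}"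
proof (rule finite_acyclic_wf)
  show "finite {(p, q). p \<in> C \<and> q \<in> C \<and> below p q}"
    by (rule finite_subset[of _ "C \<times> C"]) (use assms in auto)
  have "trans_on UNIV {(p, q). p \<in> C \<and> q \<in> C \<and> below p q}"
    by (rule transI) (auto intro: below_trans)
  then show "acyclic {(p, q). p \<in> C \<and> q \<in> C \<and> below p q}"
    by (simp add: acyclic_def trancl_id below_irrefl)
qed

text \<open>Once the sequence reaches a minimal element of its range, it can only stay
  there.\<close>

lemma eventually_constant_below:
  assumes fin: "finite C" and q: "\<And>i. q i \<in> C" "\<And>i. q (Suc i) = q i \<or> below (q (Suc i)) (q i)"
  obtains N where "\<And>i. N \<le> i \<Longrightarrow> q i = q N"
proof -
  have "\<exists>x\<in>range q. \<forall>y. (y, x) \<in> {(p, q). p \<in> C \<and> q \<in> C \<and> below p q} \<longrightarrow> y \<notin> range q"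
    using wf_below[OF fin] unfolding wf_eq_minimal by blast
  then obtain x where x: "x \<in> range q" and min: "\<And>y. y \<in> C \<Longrightarrow> below y x \<Longrightarrow> y \<notin> range q"
    using q(1) by blast
  from x obtain N where N: "x = q N" by blast
  have "q i = q N" if "N \<le> i" for i
    using that
  proof (induction rule: dec_induct)
    case (step i)
    then show ?case using q(2)[of i] min[OF q(1)[of "Suc i"]] N by auto
  qed simp
  then show thesis by (rule that)
qed

text \<open>Unrolling a discounted until replaces \<open>t\<close> by \<open>t / l\<close>, which is
  larger unless \<open>t = 0\<close>; there a genuine self-loop remains.\<close>

lemma step_atoms_below:
  assumes "in_E_fragment \<psi>" "0 \<le> t" "q \<in> pbf_atoms (step \<psi> b t \<sigma>)"
  shows "q = (\<psi>, b, t) \<or> below q (\<psi>, b, t)"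
proof -
  obtain \<chi> c s where q: "q = (\<chi>, c, s)" by (cases q)
  show ?thesis
  proof (cases \<psi>)
    case (DUntilExp l f g)
    have "t \<le> t / l"
      using assms(1,2) by (simp add: DUntilExp pos_le_divide_eq mult_left_le)
    then show ?thesis
      using assms(3) by (auto simp: q DUntilExp below_def dest!: size_step_atoms split: if_splits)
  qed (use assms(3) in \<open>auto simp: q below_def dest!: size_step_atoms\<close>)
qed

text \<open>Every other connective leads only to strictly smaller formulas. What is kept of the
  until is its value as \<open>uval\<close> and the fact that the step of \<open>g\<close> is an
  outer disjunct or conjunct.\<close>

lemma self_loop_until:
  assumes "(\<psi>, b, t) \<in> pbf_atoms (step \<psi> b t \<sigma>)" "in_E_fragment \<psi>"
  obtains l f g where
    "in_E_fragment f" "in_E_fragment g" "0 < l" "l \<le> 1" "size g < size \<psi>"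
    "\<And>\<pi>. dval \<pi> \<psi> = uval l (\<lambda>i. dval (suffix i \<pi>) f) (\<lambda>i. dval (suffix i \<pi>) g)"
    "\<And>t \<sigma>. \<exists>x. step \<psi> b t \<sigma> = pbf_join b (step g b t \<sigma>) x"
proof (cases \<psi>)
  case (DUntil f g)
  then show thesis using assms that[of f g 1] dval_DUntil_uval[of _ f g] by auto
next
  case (DUntilExp l f g)
  then show thesis using assms that[of f g "of_rat l"] dval_DUntilExp_uval[of _ l f g] by auto
qed (use assms in \<open>auto dest!: size_step_atoms\<close>)

text \<open>The strict bound on the supremum is witnessed at some \<open>i\<close>, where
  \<open>g\<close> itself exceeds \<open>t\<close>. The step of \<open>g\<close> then satisfies the
  disjunction, and its atoms are too small to be the looping state.\<close>

lemma until_progress: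
  assumes \<psi>: "in_E_fragment \<psi>" and t: "0 \<le> t"
    and loop: "(\<psi>, True, t) \<in> pbf_atoms (step \<psi> True t \<sigma>)"
    and holds: "holds \<pi> (\<psi>, True, t)"
  shows "\<exists>i. pbf_sat ({q. holds (suffix (Suc i) \<pi>) q} - {(\<psi>, True, t)}) (step \<psi> True t (\<pi> i))"
proof -
  obtain l f g where *: "in_E_fragment f" "in_E_fragment g" "0 < l" "l \<le> 1" "size g < size \<psi>"
    and dval: "\<And>\<pi>. dval \<pi> \<psi> = uval l (\<lambda>i. dval (suffix i \<pi>) f) (\<lambda>i. dval (suffix i \<pi>) g)"
    and step: "\<And>t \<sigma>. \<exists>x. step \<psi> True t \<sigma> = pbf_join True (step g True t \<sigma>) x"
    by (rule self_loop_until[OF loop \<psi>]) (rule that)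
  have "of_rat t < uval l (\<lambda>i. dval (suffix i \<pi>) f) (\<lambda>i. dval (suffix i \<pi>) g)"
    using holds by (simp add: cmp_def dval)
  then obtain i where "of_rat t < l ^ i * dval (suffix i \<pi>) g"
    using * by (subst (asm) less_uval_iff) (auto simp: dval_bounds)
  also have "\<dots> \<le> dval (suffix i \<pi>) g"
    using * by (intro discounted_le) (auto simp: dval_bounds)
  finally have "holds (suffix i \<pi>) (g, True, t)"
    by (simp add: cmp_def)
  then have "pbf_sat {q. holds (suffix (Suc i) \<pi>) q} (step g True t (\<pi> i))"
    using * by (simp only: pbf_sat_step_suffix_iff)
  moreover have "(\<psi>, True, t) \<notin> pbf_atoms (step g True t (\<pi> i))"
    using *(5) size_step_atoms by fastforce
  ultimately have "pbf_sat ({q. holds (suffix (Suc i) \<pi>) q} - {(\<psi>, True, t)}) (step g True t (\<pi> i))"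
    by (blast intro: pbf_sat_mono)
  then show ?thesis
    using step[of t "\<pi> i"] by (intro exI[of _ i]) auto
qed

text \<open>In the dual the step of \<open>g\<close> is a conjunct, so \<open>g\<close> is below
  \<open>t\<close> at every level, and finitely many suffixes make the supremum a maximum.
  Correctness is assumed only for successors other than the loop itself.\<close>

lemma until_stay_lasso:
  assumes \<psi>: "in_E_fragment \<psi>"
    and fin: "finite (range (\<lambda>i. suffix i \<pi>))"
    and loop: "(\<psi>, False, t) \<in> pbf_atoms (step \<psi> False t \<sigma>)"
    and sat: "\<And>i. pbf_sat (S i) (step \<psi> False t (\<pi> i))"
    and S: "\<And>i q. q \<in> S i \<Longrightarrow> q \<in> pbf_atoms (step \<psi> False t (\<pi> i)) \<Longrightarrow> q \<noteq> (\<psi>, False, t) \<Longrightarrow>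
      holds (suffix (Suc i) \<pi>) q"
  shows "holds \<pi> (\<psi>, False, t)"
proof -
  obtain l f g where *: "in_E_fragment f" "in_E_fragment g" "0 < l" "l \<le> 1" "size g < size \<psi>"
    and dval: "\<And>\<pi>. dval \<pi> \<psi> = uval l (\<lambda>i. dval (suffix i \<pi>) f) (\<lambda>i. dval (suffix i \<pi>) g)"
    and step: "\<And>t \<sigma>. \<exists>x. step \<psi> False t \<sigma> = pbf_join False (step g False t \<sigma>) x"
    by (rule self_loop_until[OF loop \<psi>]) (rule that)
  have "dval (suffix i \<pi>) g < of_rat t" for i
  proof -
    obtain x where x: "step \<psi> False t (\<pi> i) = pbf_join False (step g False t (\<pi> i)) x"
      using step by blast
    have "pbf_sat (S i) (step g False t (\<pi> i))"
      using sat[of i] by (simp add: x)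
    moreover have "(\<psi>, False, t) \<notin> pbf_atoms (step g False t (\<pi> i))"
      using *(5) size_step_atoms by fastforce
    then have "S i \<inter> pbf_atoms (step g False t (\<pi> i)) \<subseteq> {q. holds (suffix (Suc i) \<pi>) q}"
      using S[of _ i] by (auto simp: x simp del: split_paired_All)
    ultimately have "pbf_sat {q. holds (suffix (Suc i) \<pi>) q} (step g False t (\<pi> i))"
      by (rule pbf_sat_mono)
    then show ?thesis
      unfolding pbf_sat_step_suffix_iff[OF *(2)] by (simp add: cmp_def)
  qed
  moreover have "finite (range (\<lambda>i. dval (suffix i \<pi>) g))"
    using finite_imageI[OF fin, of "\<lambda>\<pi>. dval \<pi> g"] by (simp add: image_image)
  ultimately show ?thesis
    using * by (simp add: cmp_def dval) (rule uval_less_lasso; simp add: dval_bounds)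
qed

section \<open>The automaton\<close>

definition delta :: "'ap thr \<Rightarrow> 'ap set \<Rightarrow> 'ap thr pbf" where
  "delta = (\<lambda>(\<psi>, b, t). step \<psi> b t)"

text \<open>A lower bound \<open>> t\<close> must not be promised forever, so its states are
  rejecting; an upper bound \<open>< t\<close> may be kept forever, so its states are
  accepting.\<close>

definition thr_aba :: "'ap::countable thr set \<Rightarrow> 'ap thr \<Rightarrow> 'ap set aba" where
  "thr_aba C q\<^sub>0 =
     \<lparr>states = to_nat ` C, init = to_nat q\<^sub>0,
      trans = (\<lambda>n \<sigma>. map_pbf to_nat (delta (from_nat n) \<sigma>)),
      acc = to_nat ` {q \<in> C. \<not> fst (snd q)}\<rparr>"

text \<open>Supplies the finite prefix that is later prolonged by an endless self-loop to an
  infinite path.\<close>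

lemma run_node_path:
  "run_node A \<rho> (n, l) \<Longrightarrow> \<exists>p. p 0 = init A \<and> p l = n \<and> (\<forall>i<l. p (Suc i) \<in> \<rho> i (p i))"
proof (induction "(n, l)" arbitrary: n l rule: run_node.induct)
  case root
  then show ?case by (intro exI[of _ "\<lambda>_. init A"]) simp
next
  case (step q l q')
  then obtain p where "p 0 = init A" "p l = q" "\<forall>i<l. p (Suc i) \<in> \<rho> i (p i)"
    by blast
  with step(3) show ?case
    by (intro exI[of _ "p(Suc l := q')"]) (auto simp: less_Suc_eq)
qed

section \<open>Correctness over any finite set of states closed under transitions\<close>

context
  fixes C :: "'ap::countable thr set" and q\<^sub>0 :: "'ap thr"
  assumes fin: "finite C" and q\<^sub>0: "q\<^sub>0 \<in> C"
    and C: "\<And>\<psi> b t. (\<psi>, b, t) \<in> C \<Longrightarrow> in_E_fragment \<psi> \<and> 0 \<le> t"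
    and closed: "\<And>q \<sigma>. q \<in> C \<Longrightarrow> pbf_atoms (delta q \<sigma>) \<subseteq> C"
begin

lemma thr_aba_wf: "aba_wf (thr_aba C q\<^sub>0)"
proof -
  have "to_nat ` pbf_atoms (delta q \<sigma>) \<subseteq> to_nat ` C" if "q \<in> C" for q \<sigma>
    using closed[OF that] by (rule image_mono)
  then show ?thesis
    using fin q\<^sub>0 unfolding aba_wf_def thr_aba_def by (simp add: image_mono)
qed

lemma delta_below:
  assumes "q \<in> C" "q' \<in> pbf_atoms (delta q \<sigma>)"
  shows "q' = q \<or> below q' q"
proof (cases q)
  case (fields \<psi> b t)
  then show ?thesis
    using assms C[of \<psi> b t] step_atoms_below[of \<psi> t q' b \<sigma>] by (simp add: delta_def)
qed

text \<open>The blocks are singletons, so each lies inside or outside the accepting set. They are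
  ordered by the reflexive closure of \<open>below\<close>, carried over by the injective
  \<open>to_nat\<close>.\<close>

lemma thr_aba_weak: "aba_weak (thr_aba C q\<^sub>0)"
proof -
  define P where "P = (\<lambda>q :: 'ap thr. {to_nat q}) ` C"
  define R where "R = {({to_nat p}, {to_nat q}) | p q :: 'ap thr. p \<in> C \<and> q \<in> C \<and> (p = q \<or> below p q)}"
  have order: "partial_order_on P R"
    unfolding partial_order_on_def preorder_on_def
  proof (intro conjI)
    show "R \<subseteq> P \<times> P" by (auto simp: P_def R_def)
    show "refl_on P R" by (auto simp: P_def R_def refl_on_def)
    show "trans_on UNIV R"
    proof (rule transI)
      fix X Y Z
      assume XY: "(X, Y) \<in> R" and YZ: "(Y, Z) \<in> R"
      from XY obtain p q where p: "X = {to_nat p}" "Y = {to_nat q}" "p \<in> C" "p = q \<or> below p q"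
        unfolding R_def by blast
      from YZ obtain q' r where r: "Y = {to_nat q'}" "Z = {to_nat r}" "r \<in> C" "q' = r \<or> below q' r"
        unfolding R_def by blast
      have "q' = q" using p(2) r(1) by simp
      then show "(X, Z) \<in> R" using p r below_trans[of p q r] unfolding R_def by blast
    qed
    show "antisym_on UNIV R"
    proof (rule antisymI)
      fix X Y
      assume XY: "(X, Y) \<in> R" and YX: "(Y, X) \<in> R"
      from XY obtain p q :: "'ap thr" where p: "X = {to_nat p}" "Y = {to_nat q}" "p = q \<or> below p q"
        unfolding R_def by blast
      from YX obtain q' p' :: "'ap thr" where q: "Y = {to_nat q'}" "X = {to_nat p'}" "q' = p' \<or> below q' p'"
        unfolding R_def by blast
      have "q' = q" "p' = p" using p q by simp_all
      then show "X = Y" using p q below_trans[of p q p] below_irrefl[of p] by blast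
    qed
  qed
  have edges: "(B', B) \<in> R"
    if B: "B \<in> P" "B' \<in> P" "n \<in> B" "n' \<in> B'" "n' \<in> pbf_atoms (trans (thr_aba C q\<^sub>0) n \<sigma>)"
    for B B' n n' \<sigma>
  proof -
    obtain q q' where q: "q \<in> C" "B = {to_nat q}" "q' \<in> C" "B' = {to_nat q'}"
      using B(1,2) unfolding P_def by blast
    have "q' \<in> pbf_atoms (delta q \<sigma>)"
      using B(3-5) q by (simp add: thr_aba_def inj_image_mem_iff)
    then show ?thesis using q delta_below[of q q' \<sigma>] unfolding R_def by blast
  qed
  have cover: "\<Union> P = states (thr_aba C q\<^sub>0)"
    by (auto simp: P_def thr_aba_def)
  show ?thesis
    unfolding aba_weak_def
  proof (intro exI[of _ P] exI[of _ R] conjI ballI impI allI)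
    show "(B', B) \<in> R"
      if "B \<in> P" "B' \<in> P" "n \<in> B" "n' \<in> B'" "n' \<in> pbf_atoms (trans (thr_aba C q\<^sub>0) n \<sigma>)"
      for B B' n n' \<sigma>
      using that by (rule edges)
  qed (use order cover in \<open>auto simp: P_def\<close>)
qed

lemma delta_sat_iff:
  assumes "q \<in> C"
  shows "pbf_sat {q'. holds (suffix (Suc i) \<pi>) q'} (delta q (\<pi> i)) \<longleftrightarrow> holds (suffix i \<pi>) q"
proof (cases q)
  case (fields \<psi> b t)
  then have "in_E_fragment \<psi>" using C assms by blast
  then show ?thesis
    unfolding fields delta_def split by (rule pbf_sat_step_suffix_iff)
qed

text \<open>The run visits only states that hold at their position. Every path is eventually
  constant, and a constant state asserting \<open>> t\<close> would contradict
  \<open>until_progress\<close>.\<close>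

lemma thr_aba_complete:
  assumes "holds \<pi> q\<^sub>0"
  shows "aba_accepts (thr_aba C q\<^sub>0) \<pi>"
proof -
  let ?A = "thr_aba C q\<^sub>0"
  let ?H = "\<lambda>l. {q. holds (suffix (Suc l) \<pi>) q}"
  text \<open>The run drops a self-loop whenever the remaining successors suffice. This is what
    forces untils to be fulfilled eventually.\<close>
  define skip where "skip l q \<longleftrightarrow> pbf_sat (?H l - {q}) (delta q (\<pi> l))" for l q
  define succ where "succ l q = pbf_atoms (delta q (\<pi> l)) \<inter> (if skip l q then ?H l - {q} else ?H l)" for l q
  define \<rho> where "\<rho> l n = to_nat ` succ l (from_nat n)" for l n
  have node: "\<exists>q\<in>C. n = to_nat q \<and> holds (suffix l \<pi>) q" if "run_node ?A \<rho> (n, l)" for n l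
    using that
  proof (induction "(n, l)" arbitrary: n l rule: run_node.induct)
    case root
    then show ?case using q\<^sub>0 assms by (auto simp: thr_aba_def)
  next
    case (step n l n')
    then obtain q where "q \<in> C" "n = to_nat q" by blast
    with step(3) obtain q' where "n' = to_nat q'" "q' \<in> succ l q"
      by (auto simp: \<rho>_def)
    with closed[OF \<open>q \<in> C\<close>, of "\<pi> l"] show ?case
      by (intro bexI[of _ q']) (auto simp: succ_def split: if_splits)
  qed
  have "is_run ?A \<pi> \<rho>"
    unfolding is_run_def
  proof (intro allI impI conjI)
    fix n l
    assume "run_node ?A \<rho> (n, l)"
    then obtain q where q: "q \<in> C" "n = to_nat q" "holds (suffix l \<pi>) q"
      using node by blast
    show "\<rho> l n \<subseteq> states ?A"
      using q closed[OF q(1), of "\<pi> l"] by (auto simp: \<rho>_def succ_def thr_aba_def)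
    have "pbf_sat (?H l) (delta q (\<pi> l))"
      using delta_sat_iff[OF q(1)] q(3) by blast
    then have "pbf_sat (if skip l q then ?H l - {q} else ?H l) (delta q (\<pi> l))"
      by (simp add: skip_def)
    then have "pbf_sat (succ l q) (delta q (\<pi> l))"
      by (rule pbf_sat_mono) (auto simp: succ_def)
    then show "pbf_sat (\<rho> l n) (trans ?A n (\<pi> l))"
      by (simp add: q \<rho>_def thr_aba_def inj_vimage_image_eq)
  qed
  moreover have "accepting_run ?A \<rho>"
    unfolding accepting_run_def
  proof (intro allI impI)
    fix p
    assume p: "p 0 = init ?A \<and> (\<forall>i. p (Suc i) \<in> \<rho> i (p i))"
    have "run_node ?A \<rho> (p i, i)" for i
    proof (induction i)
      case 0
      then show ?case using p run_node.root[of ?A \<rho>] by simp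
    next
      case (Suc i)
      then show ?case using p run_node.step by blast
    qed
    then have "\<forall>i. \<exists>q\<in>C. p i = to_nat q \<and> holds (suffix i \<pi>) q"
      using node by blast
    then obtain q where q: "\<And>i. q i \<in> C" "\<And>i. p i = to_nat (q i)" "\<And>i. holds (suffix i \<pi>) (q i)"
      by metis
    have succ: "q (Suc i) \<in> succ i (q i)" for i
    proof -
      have "to_nat (q (Suc i)) \<in> \<rho> i (to_nat (q i))" using p q(2) by metis
      then show ?thesis by (auto simp: \<rho>_def)
    qed
    have decreasing: "q (Suc i) = q i \<or> below (q (Suc i)) (q i)" for i
      using succ[of i] by (intro delta_below[OF q(1)]) (auto simp: succ_def)
    obtain N where N: "\<And>i. N \<le> i \<Longrightarrow> q i = q N"
      by (rule eventually_constant_below[where q = q, OF fin q(1) decreasing]) (rule that)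
    obtain \<psi> b t where qN: "q N = (\<psi>, b, t)" by (cases "q N")
    have "\<not> b"
    proof
      assume b
      have *: "in_E_fragment \<psi>" "0 \<le> t" using C[of \<psi> b t] q(1)[of N] qN by auto
      have "(\<psi>, True, t) \<in> pbf_atoms (step \<psi> True t (\<pi> N))"
        using succ[of N] N[of "Suc N"] qN \<open>b\<close> by (simp add: succ_def delta_def)
      moreover have "holds (suffix N \<pi>) (\<psi>, True, t)"
        using q(3)[of N] qN \<open>b\<close> by simp
      ultimately obtain i where "pbf_sat ({q. holds (suffix (Suc i) (suffix N \<pi>)) q} - {(\<psi>, True, t)})
          (step \<psi> True t (suffix N \<pi> i))"
        using until_progress[OF *] by blast
      \<comment> \<open>At this level the run omits the self-loop, although the path is supposed to
        take it.\<close>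
      then have "skip (N + i) (q N)"
        using qN \<open>b\<close> by (simp add: skip_def delta_def)
      then have "q N \<notin> succ (N + i) (q N)" by (simp add: succ_def)
      then show False using succ[of "N + i"] N[of "N + i"] N[of "Suc (N + i)"] by simp
    qed
    then have "p i \<in> acc ?A" if "N \<le> i" for i
      using N[OF that] q(1)[of N] qN q(2)[of i] by (auto simp: thr_aba_def)
    then show "\<exists>\<^sub>\<infinity>i. p i \<in> acc ?A"
      unfolding INFM_nat_le by (meson le_cases)
  qed
  ultimately show ?thesis unfolding aba_accepts_def by blast
qed

text \<open>By induction along \<open>below\<close>, each node of an accepting run holds at its
  position. If the self-loop is left at some level, truth is carried back from there; otherwise
  acceptance forces the polarity \<open>< t\<close> and \<open>until_stay_lasso\<close>
  applies.\<close>

lemma thr_aba_sound_lasso: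
  assumes "is_lasso \<pi>" and "aba_accepts (thr_aba C q\<^sub>0) \<pi>"
  shows "holds \<pi> q\<^sub>0"
proof -
  let ?A = "thr_aba C q\<^sub>0"
  obtain \<rho> where run: "is_run ?A \<pi> \<rho>" and acc: "accepting_run ?A \<rho>"
    using assms(2) by (auto simp: aba_accepts_def)
  \<comment> \<open>Trimming to the occurring atoms keeps the successors inside \<open>C\<close> and
    either equal to \<open>q\<close> or below it.\<close>
  define S where "S l q = to_nat -` \<rho> l (to_nat q) \<inter> pbf_atoms (delta q (\<pi> l))" for l q
  have sat: "pbf_sat (S l q) (delta q (\<pi> l))" if "run_node ?A \<rho> (to_nat q, l)" for l q
  proof -
    have "pbf_sat (to_nat -` \<rho> l (to_nat q)) (delta q (\<pi> l))"
      using run[unfolded is_run_def, rule_format, OF that] by (simp add: thr_aba_def)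
    then show ?thesis by (rule pbf_sat_mono) (auto simp: S_def)
  qed
  have node: "run_node ?A \<rho> (to_nat q', Suc l)" if "run_node ?A \<rho> (to_nat q, l)" "q' \<in> S l q" for q q' l
    using run_node.step[OF that(1)] that(2) by (auto simp: S_def)
  have "holds (suffix l \<pi>) q" if "q \<in> C" "run_node ?A \<rho> (to_nat q, l)" for q l
    using that
  proof (induction q arbitrary: l rule: wf_induct_rule[OF wf_below[OF fin]])
    case (1 q)
    have smaller: "holds (suffix (Suc k) \<pi>) q'"
      if "run_node ?A \<rho> (to_nat q, k)" "q' \<in> S k q" "q' \<noteq> q" for q' k
    proof -
      have "q' \<in> pbf_atoms (delta q (\<pi> k))" using that(2) by (simp add: S_def)
      then have "q' \<in> C" "below q' q"
        using closed[OF 1(2)] delta_below[OF 1(2)] that(3) by blast+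
      then show ?thesis using 1(1)[of q' "Suc k"] 1(2) node[OF that(1,2)] by blast
    qed
    \<comment> \<open>Smaller successors hold by induction, so only the self-loop still needs truth
      at the next level.\<close>
    have backward: "holds (suffix k \<pi>) q"
      if "run_node ?A \<rho> (to_nat q, k)" "q \<in> S k q \<Longrightarrow> holds (suffix (Suc k) \<pi>) q" for k
    proof -
      have "S k q \<subseteq> {q. holds (suffix (Suc k) \<pi>) q}"
        using smaller[OF that(1)] that(2) by blast
      then have "pbf_sat {q. holds (suffix (Suc k) \<pi>) q} (delta q (\<pi> k))"
        using pbf_sat_mono[OF sat[OF that(1)]] by blast
      then show ?thesis using delta_sat_iff[OF 1(2)] by blast
    qed
    show ?case
    proof (cases "\<exists>k\<ge>l. q \<notin> S k q")
      case True
      \<comment> \<open>The first level at which the self-loop is not taken; there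
        \<open>backward\<close> needs nothing from the next level.\<close>
      define m where "m = (LEAST k. l \<le> k \<and> q \<notin> S k q)"
      have m: "l \<le> m" "q \<notin> S m q"
        using LeastI_ex[of "\<lambda>k. l \<le> k \<and> q \<notin> S k q"] True by (auto simp: m_def)
      have loop: "q \<in> S k q" if "l \<le> k" "k < m" for k
        using not_less_Least[of k "\<lambda>k. l \<le> k \<and> q \<notin> S k q"] that by (auto simp: m_def)
      have nodes: "run_node ?A \<rho> (to_nat q, k)" if "l \<le> k" "k \<le> m" for k
        using that
      proof (induction rule: dec_induct)
        case (step k)
        then show ?case using node loop by auto
      qed (use 1(3) in simp)
      from m(1) show ?thesis
      proof (induction rule: inc_induct)
        case base
        show ?case using backward[of m] nodes[of m] m by blast
      next
        case (step k)
        then show ?case using backward[OF nodes[OF step(1) less_imp_le[OF step(2)]]] by blast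
      qed
    next
      case False
      then have loop: "q \<in> S k q" if "l \<le> k" for k using that by blast
      have nodes: "run_node ?A \<rho> (to_nat q, k)" if "l \<le> k" for k
        using that
      proof (induction rule: dec_induct)
        case (step k)
        then show ?case using node loop by auto
      qed (use 1(3) in simp)
      obtain \<psi> b t where q: "q = (\<psi>, b, t)" by (cases q)
      have "\<not> b"
      proof
        assume b
        obtain p where p: "p 0 = init ?A" "p l = to_nat q" "\<And>i. i < l \<Longrightarrow> p (Suc i) \<in> \<rho> i (p i)"
          using run_node_path[OF 1(3)] by blast
        \<comment> \<open>An infinite path of the run that stays in \<open>q\<close> from level
          \<open>l\<close> on; acceptance makes \<open>q\<close> accepting.\<close>
        define p' where "p' i = (if i < l then p i else to_nat q)" for i
        have "p' (Suc i) \<in> \<rho> i (p' i)" for i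
          using p(2) p(3)[of i] loop[of i] by (cases "Suc i = l") (auto simp: p'_def S_def)
        moreover have "p' 0 = init ?A" using p by (auto simp: p'_def)
        ultimately have "\<exists>\<^sub>\<infinity>i. p' i \<in> acc ?A"
          using acc by (auto simp: accepting_run_def)
        then obtain i where "l \<le> i" "p' i \<in> acc ?A"
          by (auto simp: INFM_nat_le)
        then show False using \<open>b\<close> by (auto simp: p'_def q thr_aba_def)
      qed
      have "holds (suffix l \<pi>) (\<psi>, False, t)"
      proof (rule until_stay_lasso[where S = "\<lambda>i. S (l + i) q" and \<sigma> = "\<pi> l"])
        show "in_E_fragment \<psi>" using C 1(2) q by blast
        have "range (\<lambda>i. suffix i (suffix l \<pi>)) \<subseteq> range (\<lambda>i. suffix i \<pi>)" by auto
        then show "finite (range (\<lambda>i. suffix i (suffix l \<pi>)))"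
          using finite_suffixes_lasso[OF assms(1)] finite_subset by blast
        show "(\<psi>, False, t) \<in> pbf_atoms (step \<psi> False t (\<pi> l))"
          using loop[of l] \<open>\<not> b\<close> by (simp add: S_def q delta_def)
        show "pbf_sat (S (l + i) q) (step \<psi> False t (suffix l \<pi> i))" for i
          using sat[OF nodes[of "l + i"]] \<open>\<not> b\<close> by (simp add: q delta_def)
        show "holds (suffix (Suc i) (suffix l \<pi>)) q'" if "q' \<in> S (l + i) q" "q' \<noteq> (\<psi>, False, t)" for i q'
          using smaller[OF nodes[of "l + i"] that(1)] that(2) \<open>\<not> b\<close> q by simp
      qed
      moreover have "q = (\<psi>, False, t)" using q \<open>\<not> b\<close> by simp
      ultimately show ?thesis by (simp only:)
    qed
  qed
  from this[OF q\<^sub>0, of 0] show ?thesis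
    using run_node.root[of ?A \<rho>] by (simp add: thr_aba_def)
qed

end

section \<open>Reachable thresholds\<close>

text \<open>The thresholds met while a discounted until is unrolled, up to the cutoff at 1.\<close>

definition scaled :: "rat \<Rightarrow> rat set \<Rightarrow> rat set" where
  "scaled l T = {t / l ^ i | t i. t \<in> T \<and> t / l ^ i \<le> 1}"

text \<open>A structural closure of the thresholds \<open>T\<close> under transitions. Polarities
  are left out here; both are added to each pair when the state set is formed.\<close>

fun reach :: "'ap dltl \<Rightarrow> rat set \<Rightarrow> ('ap dltl \<times> rat) set" where
  "reach DTrue T = {DTrue} \<times> T"
| "reach (DProp p) T = {DProp p} \<times> T"
| "reach (DNot f) T = {DNot f} \<times> T \<union> reach f ((\<lambda>t. 1 - t) ` T)"
| "reach (DOr f g) T = {DOr f g} \<times> T \<union> reach f T \<union> reach g T"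
| "reach (DNext f) T = {DNext f} \<times> T \<union> reach f T"
| "reach (DUntil f g) T = {DUntil f g} \<times> T \<union> reach f T \<union> reach g T"
| "reach (DUntilExp l f g) T =
     {DUntilExp l f g} \<times> scaled l T \<union> reach f (scaled l T) \<union> reach g (scaled l T)"

lemma scaledI: "t \<in> T \<Longrightarrow> t / l ^ i \<le> 1 \<Longrightarrow> t / l ^ i \<in> scaled l T"
  by (auto simp: scaled_def)

lemma scaled_unit: "T \<subseteq> {0..1} \<Longrightarrow> 0 < l \<Longrightarrow> scaled l T \<subseteq> {0..1}"
  by (auto simp: scaled_def)

lemma scaled_superset:
  assumes "T \<subseteq> {0..1}"
  shows "T \<subseteq> scaled l T"
proof
  fix t assume "t \<in> T"
  then show "t \<in> scaled l T"
    using scaledI[of t T l 0] assms by auto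
qed

lemma scaled_closed:
  assumes "t \<in> scaled l T" "t / l \<le> 1"
  shows "t / l \<in> scaled l T"
proof -
  obtain s i where "s \<in> T" "t = s / l ^ i" using assms(1) by (auto simp: scaled_def)
  then show ?thesis
    using scaledI[of s T l "Suc i"] assms(2) by (simp add: mult.commute)
qed

lemma reach_self: "t \<in> T \<Longrightarrow> T \<subseteq> {0..1} \<Longrightarrow> (\<psi>, t) \<in> reach \<psi> T"
  using scaled_superset by (cases \<psi>) auto

lemma complement_unit: "T \<subseteq> {0..1} \<Longrightarrow> (\<lambda>t :: rat. 1 - t) ` T \<subseteq> {0..1}"
  by auto

lemma reach_invariants:
  "in_E_fragment \<psi> \<Longrightarrow> T \<subseteq> {0..1} \<Longrightarrow> reach \<psi> T \<subseteq> Collect in_E_fragment \<times> {0..1}"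
proof (induction \<psi> arbitrary: T)
  case (DNot f)
  then show ?case
    unfolding reach.simps using complement_unit[of T] by (intro Un_least Sigma_mono) simp_all
next
  case (DUntilExp l f g)
  then show ?case
    unfolding reach.simps using scaled_unit[of T l] by (intro Un_least Sigma_mono) simp_all
qed (unfold reach.simps, (intro Un_least Sigma_mono; simp)+)

lemma step_atoms_reach:
  assumes "in_E_fragment \<psi>" "T \<subseteq> {0..1}" "t \<in> T"
  shows "(\<chi>, c, s) \<in> pbf_atoms (step \<psi> b t \<sigma>) \<Longrightarrow> (\<chi>, s) \<in> reach \<psi> T"
  using assms
proof (induction \<psi> arbitrary: T t b)
  case (DNot f)
  show ?case using DNot.IH[OF _ _ complement_unit] DNot.prems by auto
next
  case (DNext f)
  then show ?case by (auto intro: reach_self)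
next
  case (DOr f g)
  then show ?case by simp blast
next
  case (DUntil f g)
  then show ?case by simp blast
next
  case (DUntilExp l f g)
  have l: "scaled l T \<subseteq> {0..1}" "t \<in> scaled l T"
    using DUntilExp.prems scaled_unit[of T l] scaled_superset[of T l] by auto
  then show ?case
    using DUntilExp.IH[OF _ _ l] DUntilExp.prems scaled_closed[OF l(2)] by (auto split: if_splits)
qed auto

text \<open>Pairs inside an operand are covered by induction, and pairs at the root by
  \<open>step_atoms_reach\<close>.\<close>

lemma reach_closed:
  assumes "in_E_fragment \<psi>" "T \<subseteq> {0..1}" "(\<xi>, t) \<in> reach \<psi> T" "(\<chi>, c, s) \<in> pbf_atoms (step \<xi> b t \<sigma>)"
  shows "(\<chi>, s) \<in> reach \<psi> T"
  using assms
proof (induction \<psi> arbitrary: T)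
  case DTrue
  then show ?case by auto
next
  case (DProp p)
  then show ?case by auto
next
  case (DNot f)
  show ?case
  proof (cases "(\<xi>, t) \<in> reach f ((\<lambda>t. 1 - t) ` T)")
    case True
    then show ?thesis using DNot.IH[OF _ complement_unit] DNot.prems by auto
  next
    case False
    then show ?thesis using DNot.prems step_atoms_reach[of "DNot f" T t] by auto
  qed
next
  case (DOr f g)
  consider "(\<xi>, t) \<in> reach f T" | "(\<xi>, t) \<in> reach g T" | "\<xi> = DOr f g" "t \<in> T"
    using DOr.prems by auto
  then show ?case
    by cases (use DOr.IH[of T] DOr.prems step_atoms_reach[of "DOr f g" T t] in simp_all)
next
  case (DNext f)
  consider "(\<xi>, t) \<in> reach f T" | "\<xi> = DNext f" "t \<in> T"
    using DNext.prems by auto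
  then show ?case
    by cases (use DNext.IH[of T] DNext.prems step_atoms_reach[of "DNext f" T t] in simp_all)
next
  case (DUntil f g)
  consider "(\<xi>, t) \<in> reach f T" | "(\<xi>, t) \<in> reach g T" | "\<xi> = DUntil f g" "t \<in> T"
    using DUntil.prems by auto
  then show ?case
  proof cases
    case 3
    then show ?thesis using DUntil.prems by (intro step_atoms_reach) auto
  qed (use DUntil.IH[of T] DUntil.prems in simp_all)
next
  case (DUntilExp l f g)
  let ?T = "scaled l T"
  have T: "?T \<subseteq> {0..1}" using DUntilExp.prems scaled_unit[of T l] by simp
  \<comment> \<open>Exponents add up, so the thresholds at the root, which are already scaled, yield
    nothing new.\<close>
  have idem: "scaled l ?T \<subseteq> ?T"
  proof
    fix x assume "x \<in> scaled l ?T"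
    then obtain t i j where "x = t / l ^ j / l ^ i" "t \<in> T" "x \<le> 1"
      unfolding scaled_def by blast
    then show "x \<in> ?T"
      using scaledI[of t T l "j + i"] by (simp add: power_add)
  qed
  consider "(\<xi>, t) \<in> reach f ?T" | "(\<xi>, t) \<in> reach g ?T" | "\<xi> = DUntilExp l f g" "t \<in> ?T"
    using DUntilExp.prems by auto
  then show ?case
  proof cases
    case 3
    have "scaled l ?T = ?T" using idem scaled_superset[OF T] by blast
    moreover have "(\<chi>, s) \<in> reach \<xi> ?T"
      using DUntilExp.prems T 3 by (intro step_atoms_reach) auto
    ultimately show ?thesis using 3 by simp
  qed (use DUntilExp.IH[OF _ T] DUntilExp.prems in simp_all)
qed

section \<open>Reachable thresholds by iterated refinement\<close>

text \<open>Covers one nesting level of \<^const>\<open>reach\<close> for all connectives at once.\<close>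
definition refine :: "rat set \<Rightarrow> rat set \<Rightarrow> rat set" where
  "refine L T = {s / l ^ i | s l i. (s \<in> T \<or> 1 - s \<in> T) \<and> l \<in> insert 1 L \<and> s / l ^ i \<le> 1}"

lemma refineI:
  "s \<in> T \<or> 1 - s \<in> T \<Longrightarrow> l \<in> insert 1 L \<Longrightarrow> s / l ^ i \<le> 1 \<Longrightarrow> s / l ^ i \<in> refine L T"
  unfolding refine_def by blast

lemma refine_mono: "T \<subseteq> T' \<Longrightarrow> refine L T \<subseteq> refine L T'"
  by (auto simp: refine_def)

lemma refine_superset:
  assumes "T \<subseteq> {0..1}"
  shows "T \<subseteq> refine L T"
proof
  fix t assume "t \<in> T"
  then show "t \<in> refine L T"
    using refineI[of t T 1 L 0] assms by auto
qed

lemma complement_refine: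
  assumes "T \<subseteq> {0..1}"
  shows "(\<lambda>t. 1 - t) ` T \<subseteq> refine L T"
proof (rule image_subsetI)
  fix t assume "t \<in> T"
  then show "1 - t \<in> refine L T"
    using refineI[of "1 - t" T 1 L 0] assms by auto
qed

lemma scaled_refine: "l \<in> L \<Longrightarrow> scaled l T \<subseteq> refine L T"
  by (auto simp: refine_def scaled_def)

lemma refine_unit: "T \<subseteq> {0..1} \<Longrightarrow> L \<subseteq> {0<..<1} \<Longrightarrow> refine L T \<subseteq> {0..1}"
  by (auto simp: refine_def) force+

lemma finite_subformulas: "finite (subformulas \<psi>)"
  by (induction \<psi>) auto

lemma finite_discounts: "finite (discounts \<psi>)"
  by (induction \<psi>) auto

lemma size_subformulas: "\<chi> \<in> subformulas \<psi> \<Longrightarrow> size \<chi> \<le> size \<psi>"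
  by (induction \<psi>) auto

lemma funpow_refine_mono: "T \<subseteq> T' \<Longrightarrow> (refine L ^^ n) T \<subseteq> (refine L ^^ n) T'"
  by (induction n) (simp_all add: refine_mono)

lemma funpow_refine_unit: "T \<subseteq> {0..1} \<Longrightarrow> L \<subseteq> {0<..<1} \<Longrightarrow> (refine L ^^ n) T \<subseteq> {0..1}"
  by (induction n) (simp_all add: refine_unit)

lemma funpow_refine_le:
  assumes "T \<subseteq> {0..1}" "L \<subseteq> {0<..<1}" "m \<le> n"
  shows "(refine L ^^ m) T \<subseteq> (refine L ^^ n) T"
  using assms(3)
proof (induction rule: dec_induct)
  case (step n)
  then show ?case
    using refine_superset[OF funpow_refine_unit[OF assms(1,2), of n], of L] by auto
qed simp

text \<open>The formula itself is too large to occur in its operand. Hence the number of distinct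
  subformulas, the quantity in \<open>dsize\<close>, bounds the nesting depth.\<close>

lemma card_subformulas_less:
  assumes "subformulas f \<subseteq> subformulas \<psi>" "\<psi> \<in> subformulas \<psi>" "size f < size \<psi>"
  shows "card (subformulas f) < card (subformulas \<psi>)"
proof (rule psubset_card_mono[OF finite_subformulas])
  have "\<psi> \<notin> subformulas f" using size_subformulas[of \<psi> f] assms(3) by auto
  then show "subformulas f \<subset> subformulas \<psi>" using assms(1,2) by blast
qed

lemma reach_subset:
  assumes "in_E_fragment \<psi>" "T \<subseteq> {0..1}" "discounts \<psi> \<subseteq> L" "L \<subseteq> {0<..<1}"
    and "card (subformulas \<psi>) \<le> n"
  shows "reach \<psi> T \<subseteq> subformulas \<psi> \<times> (refine L ^^ n) T"
  using assms(1,2,3,5)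
proof (induction \<psi> arbitrary: T n)
  \<comment> \<open>Passing to an operand uses up one refinement and at least one
    subformula.\<close>
  have sub: "reach f T' \<subseteq> subformulas \<psi> \<times> (refine L ^^ n) T"
    if IH: "\<And>n T. T \<subseteq> {0..1} \<Longrightarrow> card (subformulas f) \<le> n \<Longrightarrow> reach f T \<subseteq> subformulas f \<times> (refine L ^^ n) T"
    and T: "T \<subseteq> {0..1}" "T' \<subseteq> refine L T"
    and f: "subformulas f \<subseteq> subformulas \<psi>" "\<psi> \<in> subformulas \<psi>" "size f < size \<psi>"
    and n: "card (subformulas \<psi>) \<le> n" for f \<psi> :: "'a dltl" and T T' n
  proof -
    obtain k where k: "n = Suc k" "card (subformulas f) \<le> k"
      using n card_subformulas_less[OF f] by (cases n) auto
    have T': "T' \<subseteq> {0..1}" using T(2) refine_unit[OF T(1) assms(4)] by blast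
    have "reach f T' \<subseteq> subformulas f \<times> (refine L ^^ k) T'"
      using IH[OF T' k(2)] .
    also have "\<dots> \<subseteq> subformulas \<psi> \<times> (refine L ^^ k) (refine L T)"
      using f(1) funpow_refine_mono[OF T(2)] by blast
    finally show ?thesis by (simp add: k funpow_swap1)
  qed
  \<comment> \<open>A formula is its own subformula, so at least one refinement is available for the
    thresholds at the root.\<close>
  have one: "T' \<subseteq> (refine L ^^ n) T"
    if "T \<subseteq> {0..1}" "T' \<subseteq> refine L T" "card (subformulas \<psi>) \<le> n" "\<psi> \<in> subformulas \<psi>" for \<psi> :: "'a dltl" and T T' n
  proof -
    have "1 \<le> n" using that(3,4) finite_subformulas[of \<psi>] by (metis Suc_leI One_nat_def card_gt_0_iff empty_iff order.strict_trans2)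
    then show ?thesis using funpow_refine_le[OF that(1) assms(4), of 1 n] that(2) by simp
  qed
  {
    case DTrue
    then show ?case using one[where T = T and n = n and \<psi> = DTrue, OF _ refine_superset] by auto
  next
    case (DProp p)
    then show ?case using one[where T = T and n = n and \<psi> = "DProp p", OF _ refine_superset] by auto
  next
    case (DNot f)
    have "{DNot f} \<times> T \<subseteq> subformulas (DNot f) \<times> (refine L ^^ n) T"
      using one[where T = T and n = n and \<psi> = "DNot f", OF _ refine_superset] DNot.prems by auto
    moreover have "reach f ((\<lambda>t. 1 - t) ` T) \<subseteq> subformulas (DNot f) \<times> (refine L ^^ n) T"
      by (rule sub[where f = f]) (use DNot complement_refine in auto)
    ultimately show ?case by simp
  next
    case (DOr f g)
    have "{DOr f g} \<times> T \<subseteq> subformulas (DOr f g) \<times> (refine L ^^ n) T"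
      using one[where T = T and n = n and \<psi> = "DOr f g", OF _ refine_superset] DOr.prems by auto
    moreover have "reach f T \<subseteq> subformulas (DOr f g) \<times> (refine L ^^ n) T"
      by (rule sub[where f = f]) (use DOr refine_superset in auto)
    moreover have "reach g T \<subseteq> subformulas (DOr f g) \<times> (refine L ^^ n) T"
      by (rule sub[where f = g]) (use DOr refine_superset in auto)
    ultimately show ?case by simp
  next
    case (DNext f)
    have "{DNext f} \<times> T \<subseteq> subformulas (DNext f) \<times> (refine L ^^ n) T"
      using one[where T = T and n = n and \<psi> = "DNext f", OF _ refine_superset] DNext.prems by auto
    moreover have "reach f T \<subseteq> subformulas (DNext f) \<times> (refine L ^^ n) T"
      by (rule sub[where f = f]) (use DNext refine_superset in auto)
    ultimately show ?case by simp
  next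
    case (DUntil f g)
    have "{DUntil f g} \<times> T \<subseteq> subformulas (DUntil f g) \<times> (refine L ^^ n) T"
      using one[where T = T and n = n and \<psi> = "DUntil f g", OF _ refine_superset] DUntil.prems by auto
    moreover have "reach f T \<subseteq> subformulas (DUntil f g) \<times> (refine L ^^ n) T"
      by (rule sub[where f = f]) (use DUntil refine_superset in auto)
    moreover have "reach g T \<subseteq> subformulas (DUntil f g) \<times> (refine L ^^ n) T"
      by (rule sub[where f = g]) (use DUntil refine_superset in auto)
    ultimately show ?case by simp
  next
    case (DUntilExp l f g)
    have l: "scaled l T \<subseteq> refine L T" using DUntilExp.prems by (intro scaled_refine) simp
    have "{DUntilExp l f g} \<times> scaled l T \<subseteq> subformulas (DUntilExp l f g) \<times> (refine L ^^ n) T"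
      using one[where n = n and \<psi> = "DUntilExp l f g", OF _ l] DUntilExp.prems by auto
    moreover have "reach f (scaled l T) \<subseteq> subformulas (DUntilExp l f g) \<times> (refine L ^^ n) T"
      by (rule sub[where f = f]) (use DUntilExp l in auto)
    moreover have "reach g (scaled l T) \<subseteq> subformulas (DUntilExp l f g) \<times> (refine L ^^ n) T"
      by (rule sub[where f = g]) (use DUntilExp l in auto)
    ultimately show ?case by simp
  }
qed

section \<open>Counting thresholds\<close>

text \<open>The denominator \<open>b\<close> need not be reduced, so complementing and scaling
  require no cancellation.\<close>

definition bounded_den :: "nat \<Rightarrow> rat set" where
  "bounded_den B = {t. 0 \<le> t \<and> t \<le> 1 \<and> (\<exists>b::nat. 0 < b \<and> b \<le> 2 ^ B \<and> t * of_nat b \<in> \<int>)}"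

definition short_rat :: "nat \<Rightarrow> rat \<Rightarrow> bool" where
  "short_rat n l \<longleftrightarrow> (\<exists>p q::nat. 0 < p \<and> p \<le> 2 ^ n \<and> 0 < q \<and> q \<le> 2 ^ n \<and> l = of_nat p / of_nat q)"

lemma bounded_den_mono: "B \<le> B' \<Longrightarrow> bounded_den B \<subseteq> bounded_den B'"
  using power_increasing[of B B' "2::nat"] unfolding bounded_den_def by (force intro: order.trans)

lemma bounded_den_complement:
  assumes "t \<in> bounded_den B"
  shows "1 - t \<in> bounded_den B"
proof -
  obtain b :: nat where b: "0 < b" "b \<le> 2 ^ B" "t * of_nat b \<in> \<int>" "0 \<le> t" "t \<le> 1"
    using assms by (auto simp: bounded_den_def)
  have "(1 - t) * of_nat b \<in> \<int>"
    using b(3) by (simp add: left_diff_distrib)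
  then show ?thesis using b by (auto simp: bounded_den_def)
qed

text \<open>\<open>t * b\<close> is a positive integer, hence at least 1.\<close>

lemma bounded_den_ge:
  assumes "t \<in> bounded_den B" "0 < t"
  shows "1 \<le> t * 2 ^ B"
proof -
  obtain b :: nat where b: "0 < b" "b \<le> 2 ^ B" "t * of_nat b \<in> \<int>"
    using assms(1) by (auto simp: bounded_den_def)
  then obtain k :: int where k: "t * of_nat b = of_int k" by (auto elim: Ints_cases)
  have "0 < t * of_nat b" using assms(2) b(1) by simp
  then have "1 \<le> t * of_nat b" by (simp add: k)
  also have "\<dots> \<le> t * of_nat (2 ^ B)"
    using assms(2) b(2) by (intro mult_left_mono) (simp_all only: of_nat_le_iff less_imp_le)
  finally show ?thesis by simp
qed

lemma bernoulli_rat: "0 \<le> x \<Longrightarrow> 1 + of_nat n * x \<le> (1 + x :: rat) ^ n"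
proof (induction n)
  case (Suc n)
  have "1 + of_nat (Suc n) * x \<le> (1 + of_nat n * x) * (1 + x)"
    using Suc.prems by (simp add: algebra_simps)
  also have "\<dots> \<le> (1 + x) ^ n * (1 + x)"
    using Suc by (intro mult_right_mono) auto
  finally show ?case by (simp add: mult.commute)
qed simp

text \<open>An \<open>n\<close>-bit description forces \<open>l \<le> 1 - 2\<^sup>-\<^sup>n\<close>, and the rest is Bernoulli's inequality for \<open>1 / l\<close>.\<close>
lemma short_rat_power_half:
  assumes "short_rat n l" "0 < l" "l < 1"
  shows "l ^ (2 ^ n) * 2 \<le> 1"
proof -
  obtain p q :: nat where pq: "0 < p" "p \<le> 2 ^ n" "0 < q" "l = of_nat p / of_nat q"
    using assms(1) by (auto simp: short_rat_def)
  \<comment> \<open>Integrality gives \<open>q \<ge> p + 1\<close>, so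
    \<open>1 / l \<ge> 1 + 1 / p \<ge> 1 + 1 / 2 ^ n\<close>.\<close>
  have "p < q" using assms(3) pq by simp
  have "(1::rat) / 2 ^ n \<le> 1 / of_nat p"
  proof (rule divide_left_mono)
    have "of_nat p \<le> (of_nat (2 ^ n) :: rat)" using pq(2) by (simp only: of_nat_le_iff)
    then show "of_nat p \<le> (2 ^ n :: rat)" by simp
  qed (use pq(1) in simp_all)
  then have "1 + 1 / 2 ^ n \<le> 1 + (1 :: rat) / of_nat p" by simp
  also have "\<dots> = of_nat (Suc p) / of_nat p" using pq(1) by (simp add: field_simps)
  also have "\<dots> \<le> of_nat q / of_nat p"
    using \<open>p < q\<close> by (intro divide_right_mono) (simp_all only: of_nat_le_iff Suc_leI of_nat_0_le_iff)
  also have "\<dots> = 1 / l" by (simp add: pq)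
  finally have inv: "1 + 1 / 2 ^ n \<le> 1 / l" .
  have "2 = 1 + of_nat (2 ^ n) * (1 / 2 ^ n :: rat)" by simp
  also have "\<dots> \<le> (1 + 1 / 2 ^ n) ^ (2 ^ n)" by (rule bernoulli_rat) simp
  also have "\<dots> \<le> (1 / l) ^ (2 ^ n)" using inv by (intro power_mono) simp_all
  finally show ?thesis
    using assms(2) by (simp add: power_one_over pos_le_divide_eq mult.commute)
qed

text \<open>Each block of \<open>2 ^ n\<close> factors \<open>l\<close> at least halves, so
  \<open>B\<close> blocks bring the power down to at most \<open>1 / 2 ^ B\<close>, whereas
  \<open>l ^ i \<ge> t \<ge> 1 / 2 ^ B\<close>.\<close>

lemma exponent_bound:
  assumes l: "short_rat n l" "0 < l" "l < 1" and t: "t \<in> bounded_den B" "0 < t" and i: "t / l ^ i \<le> 1"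
  shows "i \<le> B * 2 ^ n"
proof (rule ccontr)
  assume *: "\<not> i \<le> B * 2 ^ n"
  have "1 \<le> t * 2 ^ B" by (rule bounded_den_ge[OF t])
  also have "\<dots> \<le> l ^ i * 2 ^ B"
    using i l(2) by (intro mult_right_mono) (simp_all add: pos_divide_le_eq)
  also have "\<dots> < l ^ (B * 2 ^ n) * 2 ^ B"
    using * l by (intro mult_strict_right_mono power_strict_decreasing) simp_all
  also have "\<dots> = (l ^ (2 ^ n) * 2) ^ B"
    by (simp add: power_mult_distrib power_mult[symmetric] mult.commute)
  also have "\<dots> \<le> 1"
    using short_rat_power_half[OF l] l(2) by (intro power_le_one) simp_all
  finally show False by simp
qed

text \<open>Division by \<open>l ^ i\<close> moves the numerator power \<open>p ^ i\<close> into the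
  denominator, which costs at most \<open>n * m\<close> further bits.\<close>

lemma bounded_den_scaled:
  assumes l: "short_rat n l" "0 < l" and s: "s \<in> bounded_den B" and i: "s / l ^ i \<le> 1" "i \<le> m"
  shows "s / l ^ i \<in> bounded_den (B + n * m)"
proof -
  obtain p q :: nat where pq: "0 < p" "p \<le> 2 ^ n" "0 < q" "l = of_nat p / of_nat q"
    using l(1) by (auto simp: short_rat_def)
  obtain b :: nat where b: "0 < b" "b \<le> 2 ^ B" "s * of_nat b \<in> \<int>" "0 \<le> s"
    using s by (auto simp: bounded_den_def)
  have "p ^ i \<le> (2 ^ n) ^ i" using pq(2) by (simp add: power_mono)
  also have "\<dots> \<le> (2 ^ n) ^ m" using i(2) by (intro power_increasing) simp_all
  finally have "b * p ^ i \<le> 2 ^ B * (2 ^ n) ^ m" using b(2) by (intro mult_mono) simp_all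
  also have "\<dots> = 2 ^ (B + n * m)" by (simp add: power_add power_mult)
  finally have "b * p ^ i \<le> 2 ^ (B + n * m)" .
  moreover have "s / l ^ i * of_nat (b * p ^ i) = s * of_nat b * of_nat (q ^ i)"
    using pq by (simp add: power_divide)
  then have "s / l ^ i * of_nat (b * p ^ i) \<in> \<int>"
    using b(3) by (metis Ints_mult Ints_of_nat)
  moreover have "0 < b * p ^ i" using b(1) pq(1) by simp
  ultimately show ?thesis
    using i(1) b(4) l(2) unfolding bounded_den_def by (auto intro!: exI[of _ "b * p ^ i"] simp del: of_nat_mult)
qed

text \<open>All three claims come from one parametrization: each element is \<open>s / l ^ i\<close>
  with \<open>i \<le> B * 2 ^ n\<close>. The factor 2 in the count pays for complements, and
  \<open>card L + 1\<close> for the extra factor 1.\<close>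

lemma
  assumes T: "finite T" "T \<subseteq> bounded_den B" and L: "finite L"
    "\<And>l. l \<in> L \<Longrightarrow> short_rat n l \<and> 0 < l \<and> l < 1"
  shows refine_bounded_den: "refine L T \<subseteq> bounded_den (B + n * (B * 2 ^ n))"
    and finite_refine: "finite (refine L T)"
    and card_refine_le: "card (refine L T) \<le> 2 * card T * (card L + 1) * (B * 2 ^ n + 1)"
proof -
  let ?S = "T \<union> (\<lambda>t. 1 - t) ` T"
  let ?I = "?S \<times> insert 1 L \<times> {..B * 2 ^ n}"
  let ?f = "\<lambda>(s, l, i). s / l ^ i :: rat"
  have S: "s \<in> bounded_den B" if "s \<in> ?S" for s
    using that T(2) bounded_den_complement by auto
  have one: "short_rat n 1"
    by (auto simp: short_rat_def intro!: exI[of _ "1::nat"])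
  have rep: "\<exists>s l i. x = s / l ^ i \<and> s \<in> ?S \<and> l \<in> insert 1 L \<and> i \<le> B * 2 ^ n" if "x \<in> refine L T" for x
  proof -
    obtain s l i where x: "x = s / l ^ i" "s \<in> T \<or> 1 - s \<in> T" "l \<in> insert 1 L" "x \<le> 1"
      using \<open>x \<in> refine L T\<close> unfolding refine_def by blast
    have "s \<in> ?S"
      using x(2) by (auto intro: rev_image_eqI[of "1 - s"])
    \<comment> \<open>For \<open>l = 1\<close> or \<open>s = 0\<close> the exponent is unbounded but
      does not affect the value, so it is replaced by 0.\<close>
    show ?thesis
    proof (cases "l = 1 \<or> s = 0")
      case True
      then have "x = s / l ^ 0" using x(1) by auto
      then show ?thesis using \<open>s \<in> ?S\<close> x(3) by blast
    next
      case False
      then have "l \<in> L" "0 < s"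
        using x(3) S[OF \<open>s \<in> ?S\<close>] by (auto simp: bounded_den_def)
      then have "i \<le> B * 2 ^ n"
        using L(2)[of l] S[OF \<open>s \<in> ?S\<close>] x(1,4) by (intro exponent_bound[of n l s]) simp_all
      then show ?thesis using \<open>s \<in> ?S\<close> x by blast
    qed
  qed
  show "refine L T \<subseteq> bounded_den (B + n * (B * 2 ^ n))"
  proof
    fix x assume x: "x \<in> refine L T"
    then obtain s l i where *: "x = s / l ^ i" "s \<in> ?S" "l \<in> insert 1 L" "i \<le> B * 2 ^ n"
      using rep by blast
    have "x \<le> 1" using x by (auto simp: refine_def)
    moreover have "short_rat n l" "0 < l" using *(3) L(2) one by auto
    ultimately show "x \<in> bounded_den (B + n * (B * 2 ^ n))"
      using * S by (auto intro!: bounded_den_scaled)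
  qed
  have sub: "refine L T \<subseteq> ?f ` ?I"
  proof
    fix x assume "x \<in> refine L T"
    then obtain s l i where "x = ?f (s, l, i)" "(s, l, i) \<in> ?I"
      using rep[of x] by auto
    then show "x \<in> ?f ` ?I" by (rule image_eqI)
  qed
  have fin: "finite ?I" using T(1) L(1) by simp
  show "finite (refine L T)" using sub fin by (rule finite_surj[rotated])
  have "card (refine L T) \<le> card ?I"
    using surj_card_le[OF fin sub] .
  also have "\<dots> = card ?S * (card (insert 1 L) * (B * 2 ^ n + 1))"
    by (simp add: card_cartesian_product)
  also have "\<dots> \<le> (2 * card T) * ((card L + 1) * (B * 2 ^ n + 1))"
  proof (intro mult_mono)
    show "card ?S \<le> 2 * card T"
      using card_Un_le[of T "(\<lambda>t. 1 - t) ` T"] card_image_le[OF T(1), of "\<lambda>t. 1 - t"] by linarith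
    show "card (insert 1 L) \<le> card L + 1"
      using card_insert_le_m1[of "card L + 1" L 1] by (simp add: card_insert_if L(1))
  qed simp_all
  finally show "card (refine L T) \<le> 2 * card T * (card L + 1) * (B * 2 ^ n + 1)"
    by (simp only: mult.assoc)
qed

text \<open>One refinement multiplies the bit bound by the left side; a power of 2 keeps the
  recurrence explicit.\<close>

lemma Suc_mult_exp_le: "1 + N * 2 ^ N \<le> (2::nat) ^ (2 * N)"
proof -
  have "N + 1 \<le> 2 ^ N" using less_exp[of N] by linarith
  then have "(N + 1) * 2 ^ N \<le> 2 ^ N * 2 ^ N" by (rule mult_right_mono) simp
  moreover have "1 + N * 2 ^ N \<le> (N + 1) * 2 ^ N"
    using one_le_power[of "2 :: nat" N] by (simp add: add_mult_distrib)
  ultimately have "1 + N * 2 ^ N \<le> 2 ^ N * 2 ^ N" by (rule order.trans[rotated])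
  then show ?thesis by (simp only: power_add mult_2)
qed

text \<open>Each level adds \<open>2 * N\<close> to the exponent of the bit bound. The cardinality
  exponent grows by at most \<open>N * (2 * d + 3) + 2 \<le> N * (2 * d + 5)\<close>, and these
  increments sum to \<open>N * (d * d + 4 * d)\<close>.\<close>

lemma funpow_refine_bounds:
  assumes v: "v \<in> bounded_den N" and N: "1 \<le> N" and L: "finite L" "card L + 1 \<le> 2 ^ N"
    "\<And>l. l \<in> L \<Longrightarrow> short_rat N l \<and> 0 < l \<and> l < 1"
  shows "(refine L ^^ d) {v} \<subseteq> bounded_den (2 ^ (N * (2 * d + 1))) \<and> finite ((refine L ^^ d) {v}) \<and>
    card ((refine L ^^ d) {v}) \<le> 2 ^ (N * (d * d + 4 * d))"
proof (induction d)
  case 0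
  have "bounded_den N \<subseteq> bounded_den (2 ^ N)" by (rule bounded_den_mono) (simp add: less_imp_le)
  then show ?case using v by auto
next
  case (Suc d)
  let ?T = "(refine L ^^ d) {v}" and ?B = "2 ^ (N * (2 * d + 1)) :: nat"
  have IH: "finite ?T" "?T \<subseteq> bounded_den ?B" "card ?T \<le> 2 ^ (N * (d * d + 4 * d))"
    using Suc.IH by auto
  have "?B + N * (?B * 2 ^ N) = ?B * (1 + N * 2 ^ N)" by (simp add: algebra_simps)
  also have "\<dots> \<le> ?B * 2 ^ (2 * N)" using Suc_mult_exp_le by (rule mult_left_mono) simp
  also have "\<dots> = 2 ^ (N * (2 * Suc d + 1))"
    unfolding power_add[symmetric] by (rule arg_cong[where f = "power 2"]) (simp add: algebra_simps)
  finally have "refine L ?T \<subseteq> bounded_den (2 ^ (N * (2 * Suc d + 1)))"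
    using refine_bounded_den[OF IH(1,2) L(1,3)] bounded_den_mono by blast
  moreover have "finite (refine L ?T)" by (rule finite_refine[OF IH(1,2) L(1,3)])
  moreover have "card (refine L ?T) \<le> 2 ^ (N * (Suc d * Suc d + 4 * Suc d))"
  proof -
    have "?B * 2 ^ N + 1 \<le> 2 * (?B * 2 ^ N)" by (simp add: Suc_le_eq)
    also have "\<dots> = 2 ^ (N * (2 * d + 2) + 1)"
      by (simp add: power_add[symmetric] algebra_simps)
    finally have exp: "?B * 2 ^ N + 1 \<le> 2 ^ (N * (2 * d + 2) + 1)" .
    have "card (refine L ?T) \<le> 2 * card ?T * (card L + 1) * (?B * 2 ^ N + 1)"
      by (rule card_refine_le[OF IH(1,2) L(1,3)])
    also have "\<dots> \<le> 2 * 2 ^ (N * (d * d + 4 * d)) * 2 ^ N * 2 ^ (N * (2 * d + 2) + 1)"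
      using IH(3) L(2) exp by (intro mult_mono) simp_all
    also have "\<dots> = 2 ^ (Suc (N * (d * d + 4 * d)) + N + (N * (2 * d + 2) + 1))"
      by (simp only: power_add[symmetric] power_Suc[symmetric])
    also have "\<dots> \<le> 2 ^ (N * (Suc d * Suc d + 4 * Suc d))"
      using N by (intro power_increasing) (simp_all add: algebra_simps)
    finally show ?thesis .
  qed
  ultimately show ?case by simp
qed

section \<open>From description lengths to the number of reachable pairs\<close>

lemma less_bitlen: "n < 2 ^ bitlen n"
proof (induction n rule: bitlen.induct)
  case (1 n)
  then show ?case by (cases "n \<le> 1") auto
qed

declare bitlen.simps [simp del]

lemma bitlen_mono_bound: "bitlen n \<le> N \<Longrightarrow> n \<le> 2 ^ N"
  using less_bitlen[of n] power_increasing[of "bitlen n" N "2::nat"] by linarith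

lemma bounded_den_rat_bits:
  assumes "0 \<le> v" "v \<le> 1" "rat_bits v \<le> N"
  shows "v \<in> bounded_den N"
proof -
  obtain p q where pq: "quotient_of v = (p, q)" by (cases "quotient_of v")
  have q: "0 < q" using pq by (rule quotient_of_denom_pos)
  have "nat q \<le> 2 ^ N"
    using assms(3) by (intro bitlen_mono_bound) (simp add: rat_bits_def pq)
  moreover have "v * of_nat (nat q) \<in> \<int>"
    using q by (simp add: quotient_of_div[OF pq])
  ultimately show ?thesis using assms q by (auto simp: bounded_den_def intro!: exI[of _ "nat q"])
qed

lemma short_rat_rat_bits:
  assumes "0 < l" "rat_bits l \<le> N"
  shows "short_rat N l"
proof -
  obtain p q where pq: "quotient_of l = (p, q)" by (cases "quotient_of l")
  have q: "0 < q" using pq by (rule quotient_of_denom_pos)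
  have l: "l = of_int p / of_int q" by (rule quotient_of_div[OF pq])
  have p: "0 < p" using assms(1) q by (simp add: l zero_less_divide_iff)
  have "nat q \<le> 2 ^ N" "nat p \<le> 2 ^ N"
    by (rule bitlen_mono_bound; use assms(2) p in \<open>simp add: rat_bits_def pq\<close>)+
  then show ?thesis
    using p q unfolding short_rat_def l by (intro exI[of _ "nat p"] exI[of _ "nat q"]) simp
qed

lemma discounts_unit: "in_E_fragment \<psi> \<Longrightarrow> discounts \<psi> \<subseteq> {0<..<1}"
  by (induction \<psi>) auto

lemma subformulas_self: "\<psi> \<in> subformulas \<psi>"
  by (cases \<psi>) auto

text \<open>The total size \<open>N\<close> bounds the nesting depth, the number of discounts and
  all bit lengths. The thresholds contribute at most \<open>5 * N ^ 3\<close> to the exponent; the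
  subformulas and the factor 2 for the polarities add \<open>N + 1\<close>, giving
  \<open>7 * N ^ 3\<close>.\<close>

lemma card_reach_le:
  assumes \<phi>: "in_E_fragment \<phi>" and v: "0 \<le> v" "v \<le> 1"
  shows "finite (reach \<phi> {v}) \<and>
    2 * card (reach \<phi> {v}) \<le> 2 ^ (7 * (dsize \<phi> + rat_bits v) ^ 3)"
proof -
  define N where "N = dsize \<phi> + rat_bits v"
  define d where "d = card (subformulas \<phi>)"
  let ?L = "discounts \<phi>"
  let ?T = "(refine ?L ^^ d) {v}"
  have d: "1 \<le> d"
    using subformulas_self[of \<phi>] finite_subformulas[of \<phi>] by (auto simp: d_def Suc_le_eq card_gt_0_iff)
  have N: "d + (\<Sum>l\<in>?L. rat_bits l) \<le> N" "rat_bits v \<le> N"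
    by (simp_all add: N_def dsize_def d_def)
  have bits: "rat_bits l \<le> N" if "l \<in> ?L" for l
    using member_le_sum[of l ?L rat_bits] that finite_discounts[of \<phi>] N(1) by simp
  have "card ?L = (\<Sum>l\<in>?L. 1)" by simp
  also have "\<dots> \<le> (\<Sum>l\<in>?L. rat_bits l)"
    by (rule sum_mono) (simp add: rat_bits_def split: prod.split)
  \<comment> \<open>Every discount takes at least one bit of description, and
    \<open>d \<ge> 1\<close> leaves room for the added 1.\<close>
  finally have "card ?L + 1 \<le> N" using d N(1) by linarith
  then have cardL: "card ?L + 1 \<le> 2 ^ N" using less_exp[of N] by linarith
  have short: "short_rat N l \<and> 0 < l \<and> l < 1" if "l \<in> ?L" for l
    using short_rat_rat_bits[OF _ bits[OF that]] discounts_unit[OF \<phi>] that by auto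
  have T: "finite ?T" "card ?T \<le> 2 ^ (N * (d * d + 4 * d))"
    using funpow_refine_bounds[OF bounded_den_rat_bits[OF v N(2)] _ finite_discounts cardL short, of d]
      d N(1) by auto
  have sub: "reach \<phi> {v} \<subseteq> subformulas \<phi> \<times> ?T"
    using reach_subset[OF \<phi> _ order.refl discounts_unit[OF \<phi>]] v by (simp add: d_def)
  have fin: "finite (subformulas \<phi> \<times> ?T)" using T(1) finite_subformulas by blast
  have "2 * card (reach \<phi> {v}) \<le> 2 * (d * card ?T)"
    using card_mono[OF fin sub] by (simp add: card_cartesian_product d_def)
  also have "\<dots> \<le> 2 * (2 ^ N * 2 ^ (N * (d * d + 4 * d)))"
  proof -
    have "d \<le> 2 ^ N" using N(1) less_exp[of N] by linarith
    then show ?thesis using T(2) by (intro mult_left_mono mult_mono) simp_all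
  qed
  also have "\<dots> = 2 ^ Suc (N + N * (d * d + 4 * d))"
    by (simp only: power_add power_Suc)
  also have "\<dots> \<le> 2 ^ (7 * N ^ 3)"
  proof (rule power_increasing)
    have "d \<le> N" "1 \<le> N" using N(1) d by simp_all
    then have "d * d \<le> N * N" by (simp add: mult_mono)
    have "N \<le> N * N" using \<open>1 \<le> N\<close> by simp
    then have "d * d + 4 * d \<le> 5 * (N * N)" using \<open>d * d \<le> N * N\<close> \<open>d \<le> N\<close> by linarith
    then have "N * (d * d + 4 * d) \<le> N * (5 * (N * N))" by (rule mult_left_mono) simp
    moreover have "N \<le> N * (N * N)" using \<open>1 \<le> N\<close> by simp
    ultimately have "Suc (N + N * (d * d + 4 * d)) \<le> 7 * (N * (N * N))"
      using \<open>1 \<le> N\<close> by linarith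
    then show "Suc (N + N * (d * d + 4 * d)) \<le> 7 * N ^ 3"
      by (simp add: power3_eq_cube mult.assoc)
  qed simp
  finally show ?thesis
    using finite_subset[OF sub fin] by (simp add: N_def)
qed

section \<open>Assembly of the automaton and its size bound\<close>

theorem theorem2:
  fixes dummy :: "'ap::finite itself"
  shows "\<exists>c k::nat. \<forall>(\<phi>::'ap dltl) (v::rat).
           in_E_fragment \<phi> \<and> 0 \<le> v \<and> v \<le> 1 \<longrightarrow>
           (\<exists>A :: 'ap set aba.
              aba_wf A \<and> aba_weak A
            \<and> (\<forall>\<pi>. dval \<pi> \<phi> > real_of_rat v \<longrightarrow> aba_accepts A \<pi>)
            \<and> (\<forall>\<pi>. aba_accepts A \<pi> \<and> is_lasso \<pi> \<longrightarrow> dval \<pi> \<phi> > real_of_rat v)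
            \<and> card (states A) \<le> 2 ^ (c * (dsize \<phi> + rat_bits v) ^ k))"
proof (rule exI[of _ 7], rule exI[of _ 3], intro allI impI)
  fix \<phi> :: "'ap dltl" and v :: rat
  assume "in_E_fragment \<phi> \<and> 0 \<le> v \<and> v \<le> 1"
  then have \<phi>: "in_E_fragment \<phi>" and v: "0 \<le> v" "v \<le> 1" by auto
  \<comment> \<open>Both polarities are kept for each reachable pair, because negation switches
    between them.\<close>
  define C :: "'ap thr set" where "C = {(\<psi>, b, t). (\<psi>, t) \<in> reach \<phi> {v}}"
  let ?q = "(\<phi>, True, v)"
  have unit: "{v} \<subseteq> {0..1}" using v by simp
  have img: "C = (\<lambda>((\<psi>, t), b). (\<psi>, b, t)) ` (reach \<phi> {v} \<times> UNIV)"
    by (force simp: C_def)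
  have card: "finite (reach \<phi> {v})"
    "2 * card (reach \<phi> {v}) \<le> 2 ^ (7 * (dsize \<phi> + rat_bits v) ^ 3)"
    using card_reach_le[OF \<phi> v] by auto
  have fin: "finite C" unfolding img by (intro finite_imageI finite_cartesian_product card(1)) simp
  have init: "?q \<in> C" using reach_self[OF _ unit, of v \<phi>] by (simp add: C_def)
  have inv: "in_E_fragment \<psi> \<and> 0 \<le> t" if "(\<psi>, b, t) \<in> C" for \<psi> b t
    using that reach_invariants[OF \<phi> unit] by (auto simp: C_def)
  have closed: "pbf_atoms (delta q \<sigma>) \<subseteq> C" if "q \<in> C" for q \<sigma>
    using that reach_closed[OF \<phi> unit] by (cases q) (auto simp: C_def delta_def)
  let ?A = "thr_aba C ?q"
  have "card (states ?A) \<le> card C"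
    unfolding thr_aba_def by (simp add: card_image_le[OF fin])
  also have "\<dots> \<le> card (reach \<phi> {v} \<times> (UNIV :: bool set))"
    unfolding img by (rule card_image_le) (simp add: card(1))
  also have "\<dots> \<le> 2 ^ (7 * (dsize \<phi> + rat_bits v) ^ 3)"
    using card(2) by (simp add: card_cartesian_product mult.commute)
  finally have "card (states ?A) \<le> 2 ^ (7 * (dsize \<phi> + rat_bits v) ^ 3)" .
  moreover have "aba_wf ?A"
    using fin init inv closed by (rule thr_aba_wf)
  moreover have "aba_weak ?A"
    using fin init inv closed by (rule thr_aba_weak)
  moreover have "aba_accepts ?A \<pi>" if "of_rat v < dval \<pi> \<phi>" for \<pi>
  proof -
    have "holds \<pi> ?q" using that by (simp add: cmp_def)
    with fin init inv closed show ?thesis by (rule thr_aba_complete)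
  qed
  moreover have "of_rat v < dval \<pi> \<phi>" if "aba_accepts ?A \<pi>" "is_lasso \<pi>" for \<pi>
  proof -
    have "holds \<pi> ?q" using fin init inv closed that(2,1) by (rule thr_aba_sound_lasso)
    then show ?thesis by (simp add: cmp_def)
  qed
  ultimately show "\<exists>A :: 'ap set aba. aba_wf A \<and> aba_weak A
            \<and> (\<forall>\<pi>. dval \<pi> \<phi> > real_of_rat v \<longrightarrow> aba_accepts A \<pi>)
            \<and> (\<forall>\<pi>. aba_accepts A \<pi> \<and> is_lasso \<pi> \<longrightarrow> dval \<pi> \<phi> > real_of_rat v)
            \<and> card (states A) \<le> 2 ^ (7 * (dsize \<phi> + rat_bits v) ^ 3)"
    by blast
qed

end
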